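(* Let the setting and 3DVAR iterates be as described in the context, and assume: (1) $\Sigma$ and $A^*A$ are simultaneously diagonalized by an orthonormal basis $\{\varphi_i\}_{i\ge1}$ of $X$, with respective eigenvalues $\sigma_i$ and $a_i^2$ satisfying $\sigma_i\asymp i^{-1-2\epsilon}$ and $a_i\asymp i^{-p}$ for some $\epsilon>0$, $p>0$; (2) for some $\beta\ge0$, $\sum_{i=1}^\infty i^{2\beta}|u_{0,i}-u_i^\dagger|^2<\infty$. Fix $t\ge0$ and suppose $\tau_{\rm b},\tau_{\rm v}\in[0,1]$ satisfy $$\tau_{\rm b}\le\bar\tau_{\rm b}:=\frac{t(1+2\epsilon)+2\beta}{2(1+2\epsilon+2p)},\qquad \tau_{\rm v}<\bar\tau_{\rm v}:=\frac{t(1+2\epsilon)+2\epsilon}{1+2\epsilon+2p}.$$ Then for all $n\ge1$, $$\mathbb{E}\left[\|\bar u_n-u^\dagger\|_t^2\right]\lesssim\left(\frac n\alpha\right)^{-2\tau_{\rm b}}+\frac{\gamma^2}{\alpha}\left(\frac n\alpha\right)^{-\tau_{\rm v}}.$$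
   Context: $X,Y$ are separable Hilbert spaces, $A:X\to Y$ is a compact linear operator, $\Sigma$ is a self-adjoint positive definite operator on $X$, $u^\dagger\in X$, $\gamma>0$, $\alpha>0$. The noises $\eta_1,\eta_2,\dots$ are i.i.d. white noise $N(0,\gamma^2I)$ on $Y$ (cylindrical Gaussians when $\dim Y=\infty$, so $\mathbb{E}\|T\eta_k\|^2=\gamma^2\operatorname{Tr}(TT^* )$ for Hilbert–Schmidt $T$), and $y_k=Au^\dagger+\eta_k$. Norms: $\|x\|_t=\|\Sigma^{t/2}x\|$. Coordinates: $x_i=\langle x,\varphi_i\rangle$, $u_{0,i}=\langle u_0,\varphi_i\rangle$. 3DVAR: $u_0\in X$ is deterministic and $u_n=\mathcal{K}y_n+(I-\mathcal{K}A)u_{n-1}$ with $\mathcal{K}=(A^*A+\alpha\Sigma^{-1})^{-1}A^*$, i.e. $\mathcal{K}=\Sigma^{1/2}(\alpha I+B^*B)^{-1}B^*$ where $B=A\Sigma^{1/2}$. Iterate average: $\bar u_n=\frac1n\sum_{k=1}^nu_k$. $a_i\asymp b_i$ means $c\,b_i\le a_i\le c'b_i$ for all $i$ with constants $c,c'>0$. $a\lesssim b$ means $a\le C'b$ with a constant $C'$ independent of $n,\alpha,\gamma$ (it may depend on $A,\Sigma,u_0-u^\dagger$ and the indices $t,\beta,p,\epsilon,\tau_{\rm b},\tau_{\rm v}$). *)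

theory Defs
  imports "HOL-Probability.Probability"
begin

section \<open>Operators on Hilbert spaces\<close>

text \<open>
  A real separable Hilbert space is a type of sort
  \<open>{real_inner, banach, second_countable_topology}\<close>.
\<close>

definition compact_operator :: "('a::real_normed_vector \<Rightarrow> 'b::real_normed_vector) \<Rightarrow> bool" where
  "compact_operator A \<longleftrightarrow> linear A \<and> compact (closure (A ` cball 0 1))"

definition self_adjoint :: "('a::real_inner \<Rightarrow> 'a) \<Rightarrow> bool" where
  "self_adjoint S \<longleftrightarrow> (\<forall>x y. inner (S x) y = inner x (S y))"

definition positive_definite :: "('a::real_inner \<Rightarrow> 'a) \<Rightarrow> bool" where
  "positive_definite S \<longleftrightarrow> (\<forall>x. x \<noteq> 0 \<longrightarrow> 0 < inner (S x) x)"

text \<open>Orthonormal bases (in the Hilbert space sense) are indexed by \<open>i \<ge> 1\<close>; the value at 0 is junk.\<close>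

definition orthonormal_basis :: "(nat \<Rightarrow> 'a::real_inner) \<Rightarrow> bool" where
  "orthonormal_basis \<phi> \<longleftrightarrow>
     (\<forall>i\<ge>1. \<forall>j\<ge>1. inner (\<phi> i) (\<phi> j) = (if i = j then 1 else 0)) \<and>
     closure (span (\<phi> ` {1..})) = UNIV"

text \<open>
  \<open>op_powr S s\<close> is the power $S^s$, $s \ge 0$, of a bounded self-adjoint positive definite operator
  that has an orthonormal eigenbasis: the bounded operator acting as $\lambda^s$ on each
  eigenspace \<open>S v = \<lambda> v\<close>. Lemma \<open>op_powr_eigenbasis\<close> below shows that it exists and that it is the
  operator diagonal in the eigenbasis; for other \<open>S\<close> the value may be unspecified.
\<close>

definition op_powr :: "('a::real_normed_vector \<Rightarrow> 'a) \<Rightarrow> real \<Rightarrow> 'a \<Rightarrow> 'a" where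
  "op_powr S s = (THE P. bounded_linear P \<and>
     (\<forall>l v. S v = l *\<^sub>R v \<longrightarrow> P v = (l powr s) *\<^sub>R v))"

definition norm_scale :: "('a::real_normed_vector \<Rightarrow> 'a) \<Rightarrow> real \<Rightarrow> 'a \<Rightarrow> real" where
  "norm_scale S t x = norm (op_powr S (t / 2) x)"

definition comparable :: "(nat \<Rightarrow> real) \<Rightarrow> (nat \<Rightarrow> real) \<Rightarrow> bool" (infix "\<asymp>" 50) where
  "a \<asymp> b \<longleftrightarrow> (\<exists>c>0. \<exists>c'>0. \<forall>i\<ge>1. c * b i \<le> a i \<and> a i \<le> c' * b i)"

section \<open>White noise and cylindrical random elements\<close>

text \<open>
  A cylindrical random element \<open>\<xi>\<close> of \<open>'b\<close> is given by its pairings: \<open>\<xi> v \<omega>\<close> stands for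
  $\langle \xi(\omega), v\rangle$. White noise $N(0,\gamma^2 I)$ is the almost surely linear one whose
  pairing with \<open>v\<close> is $N(0,\gamma^2\|v\|^2)$; by linearity, the pairings are then jointly Gaussian with
  covariance $\gamma^2\langle v,w\rangle$, and the pairing with \<open>0\<close> vanishes almost surely.
\<close>

definition white_noise :: "'w measure \<Rightarrow> real \<Rightarrow> ('b::real_inner \<Rightarrow> 'w \<Rightarrow> real) \<Rightarrow> bool" where
  "white_noise M \<gamma> \<xi> \<longleftrightarrow>
     (\<forall>v. \<xi> v \<in> borel_measurable M) \<and>
     (\<forall>c v w. AE \<omega> in M. \<xi> (c *\<^sub>R v + w) \<omega> = c * \<xi> v \<omega> + \<xi> w \<omega>) \<and>
     (\<forall>v. v \<noteq> 0 \<longrightarrow> distributed M lborel (\<xi> v) (normal_density 0 (\<gamma> * norm v)))"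

text \<open>
  Independence is that of the families of pairings \<open>(\<eta> k v)\<^sub>v\<close>, each viewed as one random
  element of the product space of functions \<open>'b \<Rightarrow> real\<close>; the laws agree by \<open>white_noise\<close>.
\<close>

definition iid_white_noise :: "'w measure \<Rightarrow> real \<Rightarrow> (nat \<Rightarrow> 'b::real_inner \<Rightarrow> 'w \<Rightarrow> real) \<Rightarrow> bool" where
  "iid_white_noise M \<gamma> \<eta> \<longleftrightarrow>
     (\<forall>k\<ge>1. white_noise M \<gamma> (\<eta> k)) \<and>
     prob_space.indep_vars M (\<lambda>_. Pi\<^sub>M UNIV (\<lambda>_. borel)) (\<lambda>k \<omega> v. \<eta> k v \<omega>) {1..}"

text \<open>The data $y_k = A u^\dagger + \eta_k$, as cylindrical random elements.\<close>

definition observation ::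
    "('a \<Rightarrow> 'b::real_inner) \<Rightarrow> 'a \<Rightarrow> (nat \<Rightarrow> 'b \<Rightarrow> 'w \<Rightarrow> real) \<Rightarrow> nat \<Rightarrow> 'b \<Rightarrow> 'w \<Rightarrow> real" where
  "observation A ud \<eta> k v \<omega> = inner (A ud) v + \<eta> k v \<omega>"

text \<open>
  \<open>z\<close> is (a version of) the genuine random variable $T\xi$:
  $\langle T\xi, x\rangle = \langle \xi, T^* x\rangle$ almost surely for each \<open>x\<close>.
  For white noise \<open>\<xi>\<close> such a \<open>z\<close> exists whenever \<open>T\<close> is Hilbert--Schmidt, and it is unique
  up to null sets when \<open>'a\<close> is separable.
\<close>

definition cylindrical_image ::
    "'w measure \<Rightarrow> ('b::real_inner \<Rightarrow> 'a::real_inner) \<Rightarrow> ('b \<Rightarrow> 'w \<Rightarrow> real) \<Rightarrow> ('w \<Rightarrow> 'a) \<Rightarrow> bool" where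
  "cylindrical_image M T \<xi> z \<longleftrightarrow>
     z \<in> borel_measurable M \<and> (\<forall>x. AE \<omega> in M. inner (z \<omega>) x = \<xi> (adjoint T x) \<omega>)"

section \<open>3DVAR\<close>

text \<open>The gain $\mathcal K = \Sigma^{1/2}(\alpha I + B^*B)^{-1}B^*$ with $B = A\Sigma^{1/2}$.\<close>

definition gain ::
    "('a::real_inner \<Rightarrow> 'b::real_inner) \<Rightarrow> ('a \<Rightarrow> 'a) \<Rightarrow> real \<Rightarrow> 'b \<Rightarrow> 'a" where
  "gain A S \<alpha> =
     (let R = op_powr S (1 / 2); B = A \<circ> R
      in R \<circ> inv (\<lambda>x. \<alpha> *\<^sub>R x + adjoint B (B x)) \<circ> adjoint B)"

definition is_3dvar ::
    "'w measure \<Rightarrow> ('a::real_inner \<Rightarrow> 'b::real_inner) \<Rightarrow> ('a \<Rightarrow> 'a) \<Rightarrow> real \<Rightarrow>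
     (nat \<Rightarrow> 'b \<Rightarrow> 'w \<Rightarrow> real) \<Rightarrow> 'a \<Rightarrow> (nat \<Rightarrow> 'w \<Rightarrow> 'a) \<Rightarrow> bool" where
  "is_3dvar M A S \<alpha> y u0 u \<longleftrightarrow>
     (\<forall>\<omega>\<in>space M. u 0 \<omega> = u0) \<and>
     (\<exists>Ky. \<forall>n\<ge>1. cylindrical_image M (gain A S \<alpha>) (y n) (Ky n) \<and>
        (\<forall>\<omega>\<in>space M. u n \<omega> = Ky n \<omega> + (u (n - 1) \<omega> - gain A S \<alpha> (A (u (n - 1) \<omega>)))))"

definition iterate_average :: "(nat \<Rightarrow> 'w \<Rightarrow> 'a::real_vector) \<Rightarrow> nat \<Rightarrow> 'w \<Rightarrow> 'a" where
  "iterate_average u n \<omega> = (1 / real n) *\<^sub>R (\<Sum>k=1..n. u k \<omega>)"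

section \<open>Well-definedness of the operator powers\<close>

lemma bounded_linear_eq_on_total:
  fixes P Q :: "'a::real_normed_vector \<Rightarrow> 'b::real_normed_vector"
  assumes P: "bounded_linear P" and Q: "bounded_linear Q"
    and eq: "\<And>x. x \<in> B \<Longrightarrow> P x = Q x" and tot: "closure (span B) = UNIV"
  shows "P = Q"
proof -
  have lin: "linear P" "linear Q" using P Q by (auto simp: bounded_linear.linear)
  have "P x - Q x = 0" if "x \<in> closure (span B)" for x
  proof (rule continuous_constant_on_closure[OF _ _ that])
    show "continuous_on (closure (span B)) (\<lambda>x. P x - Q x)"
      by (intro continuous_intros linear_continuous_on P Q)
    show "\<And>x. x \<in> span B \<Longrightarrow> P x - Q x = 0"
      using linear_eq_on_span[OF lin eq] by simp
  qed
  then show ?thesis using tot by (intro ext) auto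
qed

lemma sum_split:
  fixes f :: "nat \<Rightarrow> 'a::comm_monoid_add"
  assumes "m \<le> n"
  shows "sum f {Suc 0..n} = sum f {Suc 0..m} + sum f {Suc m..n}"
  using sum.ub_add_nat[of "Suc 0" m f "n - m"] assms by simp

lemma orthonormal_basis_sum_norm:
  assumes "orthonormal_basis \<phi>"
  shows "(norm (\<Sum>i=Suc m..n. c i *\<^sub>R \<phi> i))\<^sup>2 = (\<Sum>i=Suc m..n. (c i)\<^sup>2)"
proof -
  have o: "inner (\<phi> i) (\<phi> j) = (if i = j then 1 else 0)" if "i \<ge> 1" "j \<ge> 1" for i j
    using assms that unfolding orthonormal_basis_def by blast
  have "(norm (\<Sum>i=Suc m..n. c i *\<^sub>R \<phi> i))\<^sup>2
      = (\<Sum>i=Suc m..n. \<Sum>j=Suc m..n. c i * (c j * inner (\<phi> i) (\<phi> j)))"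
    unfolding power2_norm_eq_inner inner_sum_left inner_sum_right
    by (intro sum.cong refl) (simp add: inner_commute mult.left_commute)
  also have "\<dots> = (\<Sum>i=Suc m..n. \<Sum>j=Suc m..n. if i = j then c i * c j else 0)"
    by (intro sum.cong refl) (auto simp: o)
  also have "\<dots> = (\<Sum>i=Suc m..n. (c i)\<^sup>2)"
    by (simp add: power2_eq_square)
  finally show ?thesis .
qed

lemma orthonormal_basis_bessel:
  assumes "orthonormal_basis \<phi>"
  shows "(\<Sum>i=1..n. (inner (\<phi> i) x)\<^sup>2) \<le> (norm x)\<^sup>2"
proof -
  let ?s = "\<Sum>i=Suc 0..n. inner (\<phi> i) x *\<^sub>R \<phi> i"
  have a: "inner x ?s = (\<Sum>i=Suc 0..n. (inner (\<phi> i) x)\<^sup>2)"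
    by (simp add: inner_sum_right power2_eq_square inner_commute)
  have "0 \<le> (norm (x - ?s))\<^sup>2" by simp
  also have "\<dots> = (norm x)\<^sup>2 - 2 * inner x ?s + (norm ?s)\<^sup>2"
    by (simp add: power2_norm_eq_inner inner_diff_left inner_diff_right inner_commute)
  also have "\<dots> = (norm x)\<^sup>2 - (\<Sum>i=1..n. (inner (\<phi> i) x)\<^sup>2)"
    by (simp add: a orthonormal_basis_sum_norm[OF assms])
  finally show ?thesis by simp
qed

lemma diagonal_operator_exists:
  fixes \<phi> :: "nat \<Rightarrow> 'a::{real_inner, banach}"
  assumes onb: "orthonormal_basis \<phi>" and d: "\<And>i. i \<ge> 1 \<Longrightarrow> \<bar>d i\<bar> \<le> C"
  shows "\<exists>P. bounded_linear P \<and> (\<forall>i\<ge>1. P (\<phi> i) = d i *\<^sub>R \<phi> i) \<and>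
           (\<forall>i\<ge>1. \<forall>x. inner (\<phi> i) (P x) = d i * inner (\<phi> i) x)"
proof -
  have o: "inner (\<phi> i) (\<phi> j) = (if i = j then 1 else 0)" if "i \<ge> 1" "j \<ge> 1" for i j
    using onb that unfolding orthonormal_basis_def by blast
  have C: "C \<ge> 0" using d[of 1] by simp
  define p where "p n x = (\<Sum>i=Suc 0..n. (d i * inner (\<phi> i) x) *\<^sub>R \<phi> i)" for n x
  have dsq: "(d i * z)\<^sup>2 \<le> C\<^sup>2 * z\<^sup>2" if "i \<ge> 1" for i z
    using power_mono[OF d[OF that] abs_ge_zero, of 2]
    by (simp add: power_mult_distrib mult_right_mono)
  have diff: "(norm (p n x - p m x))\<^sup>2 \<le> C\<^sup>2 * (\<Sum>i=Suc m..n. (inner (\<phi> i) x)\<^sup>2)"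
    if "m \<le> n" for m n x
  proof -
    have "p n x = p m x + (\<Sum>i=Suc m..n. (d i * inner (\<phi> i) x) *\<^sub>R \<phi> i)"
      unfolding p_def using that by (subst sum_split[of m n]) auto
    then have "(norm (p n x - p m x))\<^sup>2 = (\<Sum>i=Suc m..n. (d i * inner (\<phi> i) x)\<^sup>2)"
      by (simp add: orthonormal_basis_sum_norm[OF onb])
    also have "\<dots> \<le> (\<Sum>i=Suc m..n. C\<^sup>2 * (inner (\<phi> i) x)\<^sup>2)"
      by (intro sum_mono dsq) auto
    finally show ?thesis by (simp add: sum_distrib_left)
  qed
  have bnd: "norm (p n x) \<le> C * norm x" for n x
  proof (rule power2_le_imp_le)
    have "(norm (p n x))\<^sup>2 \<le> C\<^sup>2 * (\<Sum>i=1..n. (inner (\<phi> i) x)\<^sup>2)"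
      using diff[of 0 n x] by (simp add: p_def)
    also have "\<dots> \<le> C\<^sup>2 * (norm x)\<^sup>2"
      by (intro mult_left_mono orthonormal_basis_bessel[OF onb]) auto
    finally show "(norm (p n x))\<^sup>2 \<le> (C * norm x)\<^sup>2" by (simp add: power_mult_distrib)
  qed (use C in auto)
  have conv: "convergent (\<lambda>n. p n x)" for x
  proof -
    let ?q = "\<lambda>n. \<Sum>i=1..n. (inner (\<phi> i) x)\<^sup>2"
    have "incseq ?q" by (intro incseq_SucI) auto
    moreover have "\<And>n. ?q n \<le> (norm x)\<^sup>2" by (rule orthonormal_basis_bessel[OF onb])
    ultimately have "Cauchy ?q"
      using incseq_convergent[of ?q] by (metis LIMSEQ_imp_Cauchy)
    have "Cauchy (\<lambda>n. p n x)"
    proof (rule metric_CauchyI)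
      fix e :: real assume e: "e > 0"
      define e' where "e' = e\<^sup>2 / (C\<^sup>2 + 1)"
      have e': "e' > 0" using e by (auto simp: e'_def intro!: divide_pos_pos add_nonneg_pos)
      obtain N where N: "\<And>m n. m \<ge> N \<Longrightarrow> n \<ge> N \<Longrightarrow> dist (?q m) (?q n) < e'"
        using metric_CauchyD[OF \<open>Cauchy ?q\<close> e'] by blast
      have le: "norm (p n x - p m x) < e" if "N \<le> m" "m \<le> n" for m n
      proof (rule power2_less_imp_less)
        have "?q n = ?q m + (\<Sum>i=Suc m..n. (inner (\<phi> i) x)\<^sup>2)"
          using sum_split[OF \<open>m \<le> n\<close>] by simp
        then have "(\<Sum>i=Suc m..n. (inner (\<phi> i) x)\<^sup>2) \<le> e'"
          using N[of n m] that by (simp add: dist_real_def)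
        then have "(norm (p n x - p m x))\<^sup>2 \<le> C\<^sup>2 * e'"
          using diff[OF \<open>m \<le> n\<close>, of x] by (meson mult_left_mono order_trans zero_le_power2)
        also have "\<dots> < (C\<^sup>2 + 1) * e'" using e' by simp
        also have "\<dots> = e\<^sup>2"
          unfolding e'_def by (simp add: add_nonneg_eq_0_iff)
        finally show "(norm (p n x - p m x))\<^sup>2 < e\<^sup>2" .
      qed (use e in auto)
      show "\<exists>M. \<forall>m\<ge>M. \<forall>n\<ge>M. dist (p m x) (p n x) < e"
      proof (intro exI allI impI)
        fix m n assume "m \<ge> N" "n \<ge> N"
        then show "dist (p m x) (p n x) < e"
          using le[of m n] le[of n m] by (cases "m \<le> n") (auto simp: dist_norm norm_minus_commute)
      qed
    qed
    then show ?thesis by (rule Cauchy_convergent)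
  qed
  define P where "P x = lim (\<lambda>n. p n x)" for x
  have lim: "(\<lambda>n. p n x) \<longlonglongrightarrow> P x" for x
    using conv unfolding P_def by (simp add: convergent_LIMSEQ_iff)
  have "bounded_linear P"
  proof (rule bounded_linear_intro)
    fix x y :: 'a and r :: real
    have "p n (x + y) = p n x + p n y" for n
      by (simp add: p_def inner_add_right algebra_simps sum.distrib)
    then show "P (x + y) = P x + P y"
      using LIMSEQ_unique[OF lim[of "x + y"]] tendsto_add[OF lim[of x] lim[of y]] by simp
    have "p n (r *\<^sub>R x) = r *\<^sub>R p n x" for n
      by (simp add: p_def scaleR_sum_right algebra_simps)
    then show "P (r *\<^sub>R x) = r *\<^sub>R P x"
      using LIMSEQ_unique[OF lim[of "r *\<^sub>R x"]] tendsto_scaleR[OF tendsto_const lim[of x], of r] by simp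
    show "norm (P x) \<le> norm x * C"
      using Lim_bounded[OF tendsto_norm[OF lim[of x]], of 0 "C * norm x"] bnd by (simp add: mult.commute)
  qed
  moreover have "P (\<phi> i) = d i *\<^sub>R \<phi> i" if i: "i \<ge> 1" for i
  proof -
    have "p n (\<phi> i) = d i *\<^sub>R \<phi> i" if "n \<ge> i" for n
    proof -
      have "p n (\<phi> i) = (\<Sum>j=Suc 0..n. if j = i then d i *\<^sub>R \<phi> i else 0)"
        unfolding p_def using i by (intro sum.cong) (auto simp: o)
      then show ?thesis using i that by simp
    qed
    then have "(\<lambda>n. p n (\<phi> i)) \<longlonglongrightarrow> d i *\<^sub>R \<phi> i"
      by (intro tendsto_eventually) (auto simp: eventually_sequentially)
    then show ?thesis using lim LIMSEQ_unique by blast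
  qed
  moreover have "inner (\<phi> i) (P x) = d i * inner (\<phi> i) x" if i: "i \<ge> 1" for i x
  proof -
    have "inner (\<phi> i) (p n x) = d i * inner (\<phi> i) x" if "n \<ge> i" for n
    proof -
      have "inner (\<phi> i) (p n x) = (\<Sum>j=Suc 0..n. if j = i then d i * inner (\<phi> i) x else 0)"
        unfolding p_def inner_sum_right using i by (intro sum.cong) (auto simp: o)
      then show ?thesis using i that by simp
    qed
    then have "(\<lambda>n. inner (\<phi> i) (p n x)) \<longlonglongrightarrow> d i * inner (\<phi> i) x"
      by (intro tendsto_eventually) (auto simp: eventually_sequentially)
    then show ?thesis
      using tendsto_inner[OF tendsto_const lim[of x], of "\<phi> i"] LIMSEQ_unique by blast
  qed
  ultimately show ?thesis by blast
qed

lemma op_powr_eigenbasis: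
  fixes S :: "'a::{real_inner, banach} \<Rightarrow> 'a"
  assumes S: "bounded_linear S" "self_adjoint S" "positive_definite S"
    and onb: "orthonormal_basis \<phi>" and eig: "\<And>i. i \<ge> 1 \<Longrightarrow> S (\<phi> i) = \<sigma> i *\<^sub>R \<phi> i"
    and s: "s \<ge> 0"
  shows "bounded_linear (op_powr S s)"
    and "i \<ge> 1 \<Longrightarrow> op_powr S s (\<phi> i) = (\<sigma> i powr s) *\<^sub>R \<phi> i"
proof -
  have o: "inner (\<phi> i) (\<phi> j) = (if i = j then 1 else 0)" if "i \<ge> 1" "j \<ge> 1" for i j
    using onb that unfolding orthonormal_basis_def by blast
  have tot: "closure (span (\<phi> ` {1..})) = UNIV"
    using onb unfolding orthonormal_basis_def by blast
  have nrm: "norm (\<phi> i) = 1" if "i \<ge> 1" for i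
    using o[OF that that] by (simp add: norm_eq_sqrt_inner)
  have pos: "\<sigma> i > 0" if "i \<ge> 1" for i
  proof -
    have "\<phi> i \<noteq> 0" using nrm[OF that] by auto
    then have "0 < inner (S (\<phi> i)) (\<phi> i)"
      using S(3) unfolding positive_definite_def by blast
    then show ?thesis using eig[OF that] o[OF that that] by simp
  qed
  have le: "\<bar>\<sigma> i powr s\<bar> \<le> onorm S powr s" if "i \<ge> 1" for i
    using onorm[OF S(1), of "\<phi> i"] pos[OF that] s
    by (auto simp: eig[OF that] nrm[OF that] intro!: powr_mono2)
  obtain P where
    P: "bounded_linear P" "\<forall>i\<ge>1. P (\<phi> i) = (\<sigma> i powr s) *\<^sub>R \<phi> i"
       "\<forall>i\<ge>1. \<forall>x. inner (\<phi> i) (P x) = (\<sigma> i powr s) * inner (\<phi> i) x"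
    using diagonal_operator_exists[where d = "\<lambda>i. \<sigma> i powr s", OF onb le] by blast
  have ev: "P v = (l powr s) *\<^sub>R v" if v: "S v = l *\<^sub>R v" for l v
  proof -
    have "inner (\<phi> i) (P v - (l powr s) *\<^sub>R v) = 0" if i: "i \<ge> 1" for i
    proof -
      have "inner (S (\<phi> i)) v = inner (\<phi> i) (S v)"
        using S(2) unfolding self_adjoint_def by blast
      then have "\<sigma> i * inner (\<phi> i) v = l * inner (\<phi> i) v"
        using v eig[OF i] by simp
      then show ?thesis using P(3) i by (auto simp: inner_diff_right)
    qed
    then have "(\<lambda>x. inner x (P v - (l powr s) *\<^sub>R v)) = (\<lambda>x. 0)"
      by (intro bounded_linear_eq_on_total[OF _ _ _ tot]
          bounded_linear_inner_left bounded_linear_zero) auto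
    from fun_cong[OF this, of "P v - (l powr s) *\<^sub>R v"] show ?thesis by simp
  qed
  have "op_powr S s = P"
    unfolding op_powr_def
  proof (rule the_equality)
    show "bounded_linear P \<and> (\<forall>l v. S v = l *\<^sub>R v \<longrightarrow> P v = (l powr s) *\<^sub>R v)"
      using P(1) ev by blast
  next
    fix Q assume Q: "bounded_linear Q \<and> (\<forall>l v. S v = l *\<^sub>R v \<longrightarrow> Q v = (l powr s) *\<^sub>R v)"
    then show "Q = P"
      using P(1,2) eig by (intro bounded_linear_eq_on_total[OF _ _ _ tot]) auto
  qed
  then show "bounded_linear (op_powr S s)"
    and "i \<ge> 1 \<Longrightarrow> op_powr S s (\<phi> i) = (\<sigma> i powr s) *\<^sub>R \<phi> i"
    using P by auto
qed

end

theory Submission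
  imports Defs
begin

text \<open>
  Everything is diagonal in the basis $\varphi_i$. Write $\lambda_i = \sigma_ia_i^2$ for the eigenvalues of
  $B^*B$, $\mu_i = \lambda_i/(\alpha+\lambda_i)$ and $\rho_i = 1-\mu_i = \alpha/(\alpha+\lambda_i)$.
  The $i$-th coordinate $e_k$ of the error $u_k - u^\dagger$ obeys
  $e_k = \rho_ie_{k-1} + \langle\eta_k, \mathcal K^*\varphi_i\rangle$ with
  $\mathcal K^*\varphi_i = \frac{\sigma_i}{\alpha+\lambda_i}A\varphi_i$ (lemma \<open>error_coordinate_recursion\<close>).
  Averaging the solution of this recursion and using that the noises are independent centred Gaussians,
  the second moment of the averaged coordinate is the sum of

  \<^item> the squared bias, $(u_0-u^\dagger)_i^2$ times the square of $\frac1n\sum_{k\le n}\rho_i^k$, which is at most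
    $\min(1, \alpha/(n\lambda_i))$; and

  \<^item> the variance $\gamma^2\|\mathcal K^*\varphi_i\|^2\,\frac1{n^2}\sum_jc_j^2$, where
    $c_j = \sum_{m\le n-j}\rho_i^m$ is at most $\min(n, 1/\mu_i)$.

  A minimum of this kind is bounded by every intermediate power, so the two contributions are at most
  $(n/\alpha)^{-2\tau_{\rm b}}\lambda_i^{-2\tau_{\rm b}}(u_0-u^\dagger)_i^2$ and
  $\frac{\gamma^2}\alpha(n/\alpha)^{-\tau_{\rm v}}\sigma_i\lambda_i^{-\tau_{\rm v}}$
  (lemma \<open>average_error_coordinate_bound\<close>, from \<open>geometric_mean_bound\<close> and \<open>noise_factor_bound\<close>).
  The dependence on $n$, $\alpha$ and $\gamma$ is now separated from that on $i$.

  By Parseval's identity the norm weights the coordinates by $\sigma_i^t$. It remains that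
  $\sum_i\sigma_i^t\lambda_i^{-2\tau_{\rm b}}(u_0-u^\dagger)_i^2$ and $\sum_i\sigma_i^{t+1}\lambda_i^{-\tau_{\rm v}}$
  are finite. Since $\sigma_i\asymp i^{-1-2\epsilon}$ and $\lambda_i\asymp i^{-(1+2\epsilon+2p)}$, the condition on
  $\tau_{\rm b}$ says that the first series is dominated by the smoothness assumption on $u_0-u^\dagger$, and the
  condition on $\tau_{\rm v}$ says that the second one is dominated by $\sum_ii^s$ with some $s < -1$.

  Two points are specific to the infinite-dimensional setting. The adjoint of $A$ has to be shown to exist,
  by Riesz representation in the eigenbasis; and the noise is only cylindrical, so all probabilistic
  statements are made for the scalar pairings with $\mathcal K^*\varphi_i$.
\<close>

section \<open>Hilbert space preliminaries\<close>

lemma orthonormal_basis_inner: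
  assumes "orthonormal_basis \<phi>" "i \<ge> 1" "j \<ge> 1"
  shows "inner (\<phi> i) (\<phi> j) = (if i = j then 1 else 0)"
  using assms unfolding orthonormal_basis_def by blast

lemma orthonormal_basis_total:
  "orthonormal_basis \<phi> \<Longrightarrow> closure (span (\<phi> ` {1..})) = UNIV"
  unfolding orthonormal_basis_def by blast

text \<open>
  The partial sums of the Fourier series are contractions of \<open>x\<close>, and they fix each vector of the
  span once enough terms are taken; as the span is dense, they converge to \<open>x\<close>.
\<close>
lemma orthonormal_basis_parseval:
  fixes x :: "'a::real_inner" and \<phi> :: "nat \<Rightarrow> 'a"
  assumes onb: "orthonormal_basis \<phi>"
  shows "(\<lambda>i. (inner (\<phi> (Suc i)) x)\<^sup>2) sums (norm x)\<^sup>2"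
proof -
  define p where "p n y = (\<Sum>i=Suc 0..n. inner (\<phi> i) y *\<^sub>R \<phi> i)" for n and y :: 'a
  have p_norm: "(norm (p n y))\<^sup>2 = (\<Sum>i=Suc 0..n. (inner (\<phi> i) y)\<^sup>2)" for n y
    unfolding p_def by (rule orthonormal_basis_sum_norm[OF onb])
  have p_contr: "norm (p n y) \<le> norm y" for n y
    by (rule power2_le_imp_le)
      (use orthonormal_basis_bessel[OF onb, where x = y and n = n] in \<open>simp_all add: p_norm\<close>)
  have p_diff: "p n (y - z) = p n y - p n z" for n y z
    by (simp add: p_def inner_diff_right algebra_simps sum_subtractf)
  have p_span: "\<forall>\<^sub>F n in sequentially. p n y = y" if "y \<in> span (\<phi> ` {1..})" for y
    using that
  proof (induction rule: span_induct_alt)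
    case base
    then show ?case by (simp add: p_def)
  next
    case (step c x y)
    then obtain i where i: "x = \<phi> i" "i \<ge> 1" by auto
    have "p n (\<phi> i) = \<phi> i" if "n \<ge> i" for n
    proof -
      have "p n (\<phi> i) = (\<Sum>j=Suc 0..n. if j = i then \<phi> i else 0)"
        unfolding p_def
        by (intro sum.cong) (use i in \<open>auto simp: orthonormal_basis_inner[OF onb]\<close>)
      then show ?thesis using i that by simp
    qed
    then have "\<forall>\<^sub>F n in sequentially. p n x = x"
      unfolding i by (auto simp: eventually_sequentially)
    moreover have "p n (c *\<^sub>R x + y) = c *\<^sub>R p n x + p n y" for n
      by (simp add: p_def inner_add_right algebra_simps sum.distrib scaleR_sum_right)
    ultimately show ?case
      using step by (auto elim: eventually_elim2)
  qed
  have lim: "(\<lambda>n. p n x) \<longlonglongrightarrow> x"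
  proof (rule LIMSEQ_I)
    fix r :: real assume "r > 0"
    have "x \<in> closure (span (\<phi> ` {1..}))" using orthonormal_basis_total[OF onb] by simp
    then obtain y where y: "y \<in> span (\<phi> ` {1..})" "dist y x < r / 2"
      using \<open>r > 0\<close> unfolding closure_approachable by (meson half_gt_zero)
    obtain N where N: "\<And>n. n \<ge> N \<Longrightarrow> p n y = y"
      using p_span[OF y(1)] by (auto simp: eventually_sequentially)
    have "norm (p n x - x) < r" if "n \<ge> N" for n
    proof -
      have "norm (p n x - x) = norm (p n (x - y) - (x - y))" using N[OF that] by (simp add: p_diff)
      then have "norm (p n x - x) \<le> norm (x - y) + norm (x - y)"
        using norm_triangle_ineq4[of "p n (x - y)" "x - y"] p_contr[of n "x - y"] by linarith
      then show ?thesis using y(2) by (simp add: dist_norm norm_minus_commute)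
    qed
    then show "\<exists>N. \<forall>n\<ge>N. norm (p n x - x) < r" by blast
  qed
  have "(\<Sum>i<n. (inner (\<phi> (Suc i)) x)\<^sup>2) = (norm (p n x))\<^sup>2" for n
    unfolding p_norm using sum.atLeast_Suc_atMost_Suc_shift[of "\<lambda>i. (inner (\<phi> i) x)\<^sup>2" 0 "n - 1"]
    by (cases n) (auto simp: atLeast0AtMost lessThan_Suc_atMost)
  then show ?thesis
    unfolding sums_def using tendsto_power[OF tendsto_norm[OF lim], of 2] by simp
qed

text \<open>
  The representing vector has to be \<open>\<Sum>i. f (\<phi> i) *\<^sub>R \<phi> i\<close>. Its partial sums \<open>r n\<close> satisfy
  \<open>f (r n) = (norm (r n))\<^sup>2\<close>, so that their norms are at most the norm of \<open>f\<close>: the coefficients are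
  square summable, and the series converges by completeness.
\<close>
lemma riesz_representation:
  fixes f :: "'a::{real_inner, banach} \<Rightarrow> real" and \<phi> :: "nat \<Rightarrow> 'a"
  assumes onb: "orthonormal_basis \<phi>" and f: "bounded_linear f"
  shows "\<exists>r. \<forall>x. f x = inner x r"
proof -
  interpret f: bounded_linear f by fact
  define r where "r n = (\<Sum>i=Suc 0..n. f (\<phi> i) *\<^sub>R \<phi> i)" for n
  obtain K where K: "\<And>x. \<bar>f x\<bar> \<le> norm x * K" "K \<ge> 0"
    using f.nonneg_bounded by (auto simp: real_norm_def)
  let ?q = "\<lambda>n. \<Sum>i=Suc 0..n. (f (\<phi> i))\<^sup>2"
  have r_norm: "(norm (r n))\<^sup>2 = ?q n" for n
    unfolding r_def by (rule orthonormal_basis_sum_norm[OF onb])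
  have f_r: "f (r n) = (norm (r n))\<^sup>2" for n
    unfolding r_norm unfolding r_def by (simp add: f.sum f.scaleR power2_eq_square)
  have r_bound: "norm (r n) \<le> K" for n
  proof (cases "r n = 0")
    case False
    then have "norm (r n) * norm (r n) \<le> norm (r n) * K"
      using K(1)[of "r n"] f_r[of n] by (simp add: power2_eq_square)
    then show ?thesis using False by simp
  qed (use K in auto)
  have diff: "(norm (r n - r m))\<^sup>2 = ?q n - ?q m" if "m \<le> n" for m n
  proof -
    have "r n - r m = (\<Sum>i=Suc m..n. f (\<phi> i) *\<^sub>R \<phi> i)"
      unfolding r_def using sum_split[OF that, of "\<lambda>i. f (\<phi> i) *\<^sub>R \<phi> i"] by simp
    then show ?thesis
      using orthonormal_basis_sum_norm[OF onb, of "\<lambda>i. f (\<phi> i)" m n]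
        sum_split[OF that, of "\<lambda>i. (f (\<phi> i))\<^sup>2"] by simp
  qed
  have "incseq ?q" by (intro incseq_SucI) auto
  moreover have "\<And>n. ?q n \<le> K\<^sup>2"
    using r_bound unfolding r_norm[symmetric] by (intro power_mono) auto
  ultimately have Cq: "Cauchy ?q"
    using incseq_convergent[of ?q] by (metis LIMSEQ_imp_Cauchy)
  have "Cauchy r"
  proof (rule metric_CauchyI)
    fix e :: real assume e: "e > 0"
    then obtain N where N: "\<And>m n. m \<ge> N \<Longrightarrow> n \<ge> N \<Longrightarrow> dist (?q m) (?q n) < e\<^sup>2"
      using metric_CauchyD[OF Cq, of "e\<^sup>2"] by auto
    have le: "norm (r n - r m) < e" if "N \<le> m" "m \<le> n" for m n
    proof (rule power2_less_imp_less)
      show "(norm (r n - r m))\<^sup>2 < e\<^sup>2"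
        using diff[OF that(2)] N[of n m] that by (simp add: dist_real_def abs_less_iff)
    qed (use e in auto)
    show "\<exists>M. \<forall>m\<ge>M. \<forall>n\<ge>M. dist (r m) (r n) < e"
      using le by (metis dist_commute dist_norm nle_le)
  qed
  then obtain R where R: "r \<longlonglongrightarrow> R" using Cauchy_convergent convergent_def by blast
  have "inner (\<phi> i) R = f (\<phi> i)" if i: "i \<ge> 1" for i
  proof -
    have "inner (\<phi> i) (r n) = f (\<phi> i)" if "n \<ge> i" for n
    proof -
      have "inner (\<phi> i) (r n) = (\<Sum>j=Suc 0..n. if j = i then f (\<phi> i) else 0)"
        unfolding r_def inner_sum_right
        by (intro sum.cong) (use i in \<open>auto simp: orthonormal_basis_inner[OF onb]\<close>)
      then show ?thesis using i that by simp
    qed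
    then have "(\<lambda>n. inner (\<phi> i) (r n)) \<longlonglongrightarrow> f (\<phi> i)"
      by (intro tendsto_eventually) (auto simp: eventually_sequentially)
    then show ?thesis
      using tendsto_inner[OF tendsto_const R, of "\<phi> i"] LIMSEQ_unique by blast
  qed
  then have "f = (\<lambda>x. inner x R)"
    by (intro bounded_linear_eq_on_total[OF f _ _ orthonormal_basis_total[OF onb]]
        bounded_linear_inner_left) auto
  then show ?thesis by metis
qed

text \<open>
  The constant \<open>adjoint\<close> is a Hilbert choice among the functions that satisfy the adjoint identity.
  It satisfies this identity because Riesz representation, applied to $x \mapsto \langle Ax, y\rangle$ for
  each \<open>y\<close>, provides such a function.
\<close>
lemma adjoint_inner:
  fixes A :: "'a::{real_inner, banach} \<Rightarrow> 'b::real_inner"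
  assumes onb: "orthonormal_basis (\<phi> :: nat \<Rightarrow> 'a)" and A: "bounded_linear A"
  shows "inner (A x) y = inner x (adjoint A y)"
proof -
  have "\<exists>r. \<forall>x. inner (A x) y = inner x r" for y
    by (intro riesz_representation[OF onb] bounded_linear_compose[OF bounded_linear_inner_left A])
  then obtain g where "\<forall>x y. inner (A x) y = inner x (g y)" by metis
  then show ?thesis using adjoint_unique by metis
qed

lemma bounded_linear_adjoint:
  fixes A :: "'a::{real_inner, banach} \<Rightarrow> 'b::real_inner"
  assumes onb: "orthonormal_basis (\<phi> :: nat \<Rightarrow> 'a)" and A: "bounded_linear A"
  shows "bounded_linear (adjoint A)"
proof -
  note adj = adjoint_inner[OF onb A, symmetric]
  obtain K where K: "\<And>x. norm (A x) \<le> norm x * K" "K \<ge> 0"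
    using bounded_linear.nonneg_bounded[OF A] by auto
  show ?thesis
  proof (rule bounded_linear_intro)
    show "adjoint A (x + y) = adjoint A x + adjoint A y" for x y
      by (subst vector_eq_ldot[symmetric]) (simp add: adj inner_add_right)
    show "adjoint A (c *\<^sub>R x) = c *\<^sub>R adjoint A x" for c x
      by (subst vector_eq_ldot[symmetric]) (simp add: adj)
    show "norm (adjoint A y) \<le> norm y * K" for y
    proof (cases "adjoint A y = 0")
      case False
      have "norm (adjoint A y) * norm (adjoint A y) = inner (A (adjoint A y)) y"
        by (simp add: adjoint_inner[OF onb A] power2_norm_eq_inner flip: power2_eq_square)
      also have "\<dots> \<le> norm (A (adjoint A y)) * norm y" by (rule norm_cauchy_schwarz)
      also have "\<dots> \<le> norm (adjoint A y) * (norm y * K)"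
        using mult_right_mono[OF K(1)[of "adjoint A y"], of "norm y"] by (simp add: mult_ac)
      finally show ?thesis using False by simp
    qed (use K in auto)
  qed
qed

lemma compact_operator_imp_bounded_linear:
  fixes A :: "'a::real_normed_vector \<Rightarrow> 'b::real_normed_vector"
  assumes "compact_operator A"
  shows "bounded_linear A"
proof -
  have lin: "linear A" and "compact (closure (A ` cball 0 1))"
    using assms by (auto simp: compact_operator_def)
  then have "bounded (A ` cball 0 1)"
    by (meson bounded_subset closure_subset compact_imp_bounded)
  then obtain K where K: "\<And>x. norm x \<le> 1 \<Longrightarrow> norm (A x) \<le> K"
    unfolding bounded_iff by (metis imageI mem_cball_0)
  interpret linear A by fact
  show ?thesis
  proof (rule bounded_linear_intro[OF add scale])
    fix x :: 'a
    show "norm (A x) \<le> norm x * K"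
    proof (cases "x = 0")
      case False
      have "norm (A ((1 / norm x) *\<^sub>R x)) \<le> K" using False by (intro K) simp
      then show ?thesis using False by (simp add: scale divide_simps mult.commute)
    qed (simp add: zero)
  qed
qed

section \<open>The gain in the eigenbasis\<close>

lemma diagonal_operator_coordinate:
  fixes P :: "'a::real_inner \<Rightarrow> 'a" and \<phi> :: "nat \<Rightarrow> 'a"
  assumes onb: "orthonormal_basis \<phi>" and P: "bounded_linear P"
    and diag: "\<And>i. i \<ge> 1 \<Longrightarrow> P (\<phi> i) = d i *\<^sub>R \<phi> i" and i: "i \<ge> 1"
  shows "inner (P x) (\<phi> i) = d i * inner x (\<phi> i)"
proof -
  have "(\<lambda>x. inner (P x) (\<phi> i)) = (\<lambda>x. d i * inner x (\<phi> i))"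
  proof (rule bounded_linear_eq_on_total[OF _ _ _ orthonormal_basis_total[OF onb]])
    show "bounded_linear (\<lambda>x. inner (P x) (\<phi> i))"
      by (rule bounded_linear_compose[OF bounded_linear_inner_left P])
    show "bounded_linear (\<lambda>x. d i * inner x (\<phi> i))"
      by (rule bounded_linear_const_mult[OF bounded_linear_inner_left])
    show "inner (P x) (\<phi> i) = d i * inner x (\<phi> i)" if "x \<in> \<phi> ` {1..}" for x
      using that i by (auto simp: diag orthonormal_basis_inner[OF onb])
  qed
  then show ?thesis by metis
qed

lemma diagonal_operator_self_adjoint:
  fixes P :: "'a::real_inner \<Rightarrow> 'a" and \<phi> :: "nat \<Rightarrow> 'a"
  assumes onb: "orthonormal_basis \<phi>" and P: "bounded_linear P"
    and diag: "\<And>i. i \<ge> 1 \<Longrightarrow> P (\<phi> i) = d i *\<^sub>R \<phi> i"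
  shows "inner (P x) y = inner x (P y)"
proof -
  have "(\<lambda>x. inner (P x) y) = (\<lambda>x. inner x (P y))"
  proof (rule bounded_linear_eq_on_total[OF _ _ _ orthonormal_basis_total[OF onb]])
    show "bounded_linear (\<lambda>x. inner (P x) y)"
      by (rule bounded_linear_compose[OF bounded_linear_inner_left P])
    show "bounded_linear (\<lambda>x. inner x (P y))"
      by (rule bounded_linear_inner_left)
    show "inner (P x) y = inner x (P y)" if "x \<in> \<phi> ` {1..}" for x
      using that diagonal_operator_coordinate[OF onb P diag, where x = y]
      by (auto simp: diag inner_commute)
  qed
  then show ?thesis by metis
qed

text \<open>
  The decay rates of the eigenvalues are left out: they matter only for the convergence of the two
  series that bound the total error. Positivity of $a_i$ makes the noise in every coordinate of the
  iterates a nondegenerate Gaussian.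
\<close>
locale diagonal_problem =
  fixes A :: "'a::{real_inner, banach, second_countable_topology} \<Rightarrow>
              'b::{real_inner, banach, second_countable_topology}"
    and S :: "'a \<Rightarrow> 'a" and \<phi> :: "nat \<Rightarrow> 'a" and \<sigma> a :: "nat \<Rightarrow> real"
  assumes bounded_linear_A: "bounded_linear A"
    and S: "bounded_linear S" "self_adjoint S" "positive_definite S"
    and basis: "orthonormal_basis \<phi>"
    and eig_S: "i \<ge> 1 \<Longrightarrow> S (\<phi> i) = \<sigma> i *\<^sub>R \<phi> i"
    and eig_A: "i \<ge> 1 \<Longrightarrow> adjoint A (A (\<phi> i)) = (a i)\<^sup>2 *\<^sub>R \<phi> i"
    and a_pos: "i \<ge> 1 \<Longrightarrow> 0 < a i"
begin

text \<open>
  The eigenvalues of $B^*B$ for $B = A\Sigma^{1/2}$.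
\<close>
definition ev :: "nat \<Rightarrow> real" where
  "ev i = \<sigma> i * (a i)\<^sup>2"

lemma \<sigma>_pos:
  assumes "i \<ge> 1"
  shows "0 < \<sigma> i"
proof -
  have "inner (\<phi> i) (\<phi> i) = 1" using orthonormal_basis_inner[OF basis] assms by simp
  moreover from this have "\<phi> i \<noteq> 0" by auto
  then have "0 < inner (S (\<phi> i)) (\<phi> i)"
    using S(3) unfolding positive_definite_def by blast
  ultimately show ?thesis using eig_S[OF assms] by simp
qed

lemma ev_pos: "i \<ge> 1 \<Longrightarrow> 0 < ev i"
  unfolding ev_def by (intro mult_pos_pos zero_less_power \<sigma>_pos a_pos)

lemma norm_A_basis:
  assumes "i \<ge> 1"
  shows "norm (A (\<phi> i)) = a i"
proof -
  have "(norm (A (\<phi> i)))\<^sup>2 = (a i)\<^sup>2"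
    using assms by (simp add: power2_norm_eq_inner adjoint_inner[OF basis bounded_linear_A]
        eig_A orthonormal_basis_inner[OF basis])
  then show ?thesis using a_pos[OF assms] by simp
qed

text \<open>
  Parseval's identity for $\Sigma^{t/2}x$, which reduces the theorem to a bound in each coordinate.
\<close>
lemma norm_scale_sums:
  assumes "t \<ge> 0"
  shows "(\<lambda>i. \<sigma> (Suc i) powr t * (inner x (\<phi> (Suc i)))\<^sup>2) sums (norm_scale S t x)\<^sup>2"
proof -
  note pow = op_powr_eigenbasis[OF S basis eig_S, where s = "t / 2"]
  have "inner (\<phi> (Suc i)) (op_powr S (t / 2) x) = \<sigma> (Suc i) powr (t / 2) * inner x (\<phi> (Suc i))" for i
    using diagonal_operator_coordinate[OF basis pow(1) pow(2), where i = "Suc i"] assms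
    by (simp add: inner_commute)
  moreover have "(\<sigma> (Suc i) powr (t / 2))\<^sup>2 = \<sigma> (Suc i) powr t" for i
    by (simp add: power2_eq_square flip: powr_add)
  ultimately show ?thesis
    using orthonormal_basis_parseval[OF basis, where x = "op_powr S (t / 2) x"]
    by (simp add: norm_scale_def power_mult_distrib)
qed

text \<open>
  The gain maps into \<open>'a\<close>, where a basis is available, but its domain \<open>'b\<close> carries none. Its action is
  therefore read off from its adjoint, which is the form in which a cylindrical noise needs it:
  the $i$-th coordinate of $\mathcal K\eta$ is the pairing of $\eta$ with $\mathcal K^*\varphi_i$.
  With $R = \Sigma^{1/2}$ and the diagonal inverse $D = (\alpha I + B^*B)^{-1}$ one has
  $\mathcal K = RDRA^*$ and $\mathcal K^* = ARDR$.
\<close>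
lemma gain_diagonal:
  assumes \<alpha>: "\<alpha> > 0"
  shows bounded_linear_gain: "bounded_linear (gain A S \<alpha>)"
    and adjoint_gain_basis: "i \<ge> 1 \<Longrightarrow> adjoint (gain A S \<alpha>) (\<phi> i) = (\<sigma> i / (\<alpha> + ev i)) *\<^sub>R A (\<phi> i)"
    and gain_inner: "inner (gain A S \<alpha> y) x = inner y (adjoint (gain A S \<alpha>) x)"
proof -
  define R where "R = op_powr S (1 / 2)"
  define B where "B = A \<circ> R"
  define F where "F x = \<alpha> *\<^sub>R x + adjoint B (B x)" for x
  note pow = op_powr_eigenbasis[OF S basis eig_S, where s = "1 / 2"]
  have R: "bounded_linear R" unfolding R_def by (rule pow(1)) auto
  have R_\<phi>: "R (\<phi> i) = sqrt (\<sigma> i) *\<^sub>R \<phi> i" if "i \<ge> 1" for i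
    unfolding R_def using pow(2) that \<sigma>_pos[OF that] by (simp add: powr_half_sqrt)
  have R_adj: "inner (R x) y = inner x (R y)" for x y
    by (rule diagonal_operator_self_adjoint[OF basis R R_\<phi>])
  have A_adj: "inner (A x) y = inner x (adjoint A y)" for x y
    by (rule adjoint_inner[OF basis bounded_linear_A])
  have B: "bounded_linear B"
    unfolding B_def comp_def by (rule bounded_linear_compose[OF bounded_linear_A R])
  have adj_B: "adjoint B = R \<circ> adjoint A"
    by (rule adjoint_unique) (simp add: B_def A_adj R_adj)
  have bl_adj_A: "bounded_linear (adjoint A)"
    by (rule bounded_linear_adjoint[OF basis bounded_linear_A])
  have F: "bounded_linear F"
    unfolding F_def
    by (intro bounded_linear_add bounded_linear_scaleR_right
        bounded_linear_compose[OF bounded_linear_adjoint[OF basis B] B])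
  have F_\<phi>: "F (\<phi> i) = (\<alpha> + ev i) *\<^sub>R \<phi> i" if "i \<ge> 1" for i
  proof -
    interpret R: bounded_linear R by (rule R)
    interpret AA: bounded_linear "\<lambda>x. adjoint A (A x)"
      by (rule bounded_linear_compose[OF bl_adj_A bounded_linear_A])
    show ?thesis
      using that \<sigma>_pos[OF that]
      by (simp add: F_def adj_B[unfolded B_def] B_def R_\<phi> AA.scaleR eig_A R.scaleR ev_def algebra_simps)
  qed
  obtain D where D: "bounded_linear D" "\<And>i. i \<ge> 1 \<Longrightarrow> D (\<phi> i) = (1 / (\<alpha> + ev i)) *\<^sub>R \<phi> i"
  proof -
    have "\<bar>1 / (\<alpha> + ev i)\<bar> \<le> 1 / \<alpha>" if "i \<ge> 1" for i
      using ev_pos[OF that] \<alpha> by (simp add: frac_le)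
    from diagonal_operator_exists[where d = "\<lambda>i. 1 / (\<alpha> + ev i)", OF basis this] show ?thesis using that by blast
  qed
  interpret R: bounded_linear R by (rule R)
  interpret F: bounded_linear F by (rule F)
  interpret D: bounded_linear D by (rule D(1))
  have ne: "\<alpha> + ev i \<noteq> 0" if "i \<ge> 1" for i using ev_pos[OF that] \<alpha> by simp
  have "F \<circ> D = id" "D \<circ> F = id"
    unfolding comp_def id_def
    by (rule bounded_linear_eq_on_total[OF _ _ _ orthonormal_basis_total[OF basis]];
        force intro: bounded_linear_compose[OF F D(1)] bounded_linear_compose[OF D(1) F]
          bounded_linear_ident simp: F_\<phi> D(2) F.scaleR D.scaleR ne)+
  then have "inv F = D" by (rule inv_unique_comp)
  then have gain: "gain A S \<alpha> = (\<lambda>y. R (D (R (adjoint A y))))"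
    unfolding gain_def R_def[symmetric] Let_def B_def[symmetric] F_def[symmetric]
    by (auto simp: adj_B)
  show "bounded_linear (gain A S \<alpha>)"
    unfolding gain
    by (rule bounded_linear_compose[OF R bounded_linear_compose[OF D(1)
          bounded_linear_compose[OF R bl_adj_A]]])
  have D_adj: "inner (D x) y = inner x (D y)" for x y
    by (rule diagonal_operator_self_adjoint[OF basis D])
  have gain_adj: "inner (gain A S \<alpha> y) x = inner y (A (R (D (R x))))" for x y
  proof -
    have "inner (gain A S \<alpha> y) x = inner (adjoint A y) (R (D (R x)))"
      by (simp add: gain R_adj D_adj)
    also have "\<dots> = inner y (A (R (D (R x))))"
      using A_adj[of "R (D (R x))" y] by (metis inner_commute)
    finally show ?thesis .
  qed
  then have adj_gain: "adjoint (gain A S \<alpha>) = (\<lambda>x. A (R (D (R x))))"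
    by (intro adjoint_unique) auto
  show "inner (gain A S \<alpha> y) x = inner y (adjoint (gain A S \<alpha>) x)"
    unfolding adj_gain by (rule gain_adj)
  show "adjoint (gain A S \<alpha>) (\<phi> i) = (\<sigma> i / (\<alpha> + ev i)) *\<^sub>R A (\<phi> i)" if "i \<ge> 1"
    unfolding adj_gain using that \<sigma>_pos[OF that]
    by (simp add: R_\<phi> D(2) R.scaleR D.scaleR linear_scale[OF bounded_linear.linear[OF bounded_linear_A]]
        power2_eq_square)
qed

lemma gain_A_coordinate:
  assumes "\<alpha> > 0" "i \<ge> 1"
  shows "inner (gain A S \<alpha> (A x)) (\<phi> i) = ev i / (\<alpha> + ev i) * inner x (\<phi> i)"
  using assms by (simp add: gain_inner adjoint_gain_basis adjoint_inner[OF basis bounded_linear_A]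
      eig_A ev_def)

end

section \<open>Scalar bounds on bias and noise amplification\<close>

text \<open>
  This interpolation is how the free exponents $\tau_{\rm b}$ and $\tau_{\rm v}$ enter: each coordinate is
  bounded by two competing quantities, and every intermediate power of their quotient is a bound.
\<close>
lemma min_one_square_le_powr:
  fixes z \<theta> :: real
  assumes "z > 0" "0 \<le> \<theta>" "\<theta> \<le> 2"
  shows "min 1 (z\<^sup>2) \<le> z powr \<theta>"
proof (cases "z \<ge> 1")
  case True
  then have "1 \<le> z powr \<theta>" using assms by (intro ge_one_powr_ge_zero) auto
  then show ?thesis by simp
next
  case False
  then have "z powr 2 \<le> z powr \<theta>" using assms by (intro powr_mono') auto
  then show ?thesis using assms by simp
qed

lemma geometric_sum_from_1:
  fixes \<rho> :: real
  shows "(1 - \<rho>) * (\<Sum>k=1..n. \<rho> ^ k) = \<rho> - \<rho> ^ Suc n"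
proof (induction n)
  case (Suc n)
  have "(1 - \<rho>) * (\<Sum>k=1..Suc n. \<rho> ^ k) = (1 - \<rho>) * (\<Sum>k=1..n. \<rho> ^ k) + (1 - \<rho>) * \<rho> ^ Suc n"
    by (simp add: distrib_left)
  also have "\<dots> = \<rho> - \<rho> ^ Suc n + (1 - \<rho>) * \<rho> ^ Suc n" by (simp only: Suc.IH)
  finally show ?case by (simp add: left_diff_distrib)
qed simp

text \<open>
  The mean of $n$ powers of the contraction factor $\rho = \alpha/(\alpha+l)$ is at most $1$ trivially,
  and at most $\rho/(n(1-\rho)) = \alpha/(nl)$ by summing the geometric series.
\<close>
lemma geometric_mean_bound:
  fixes \<alpha> l \<tau> :: real
  assumes "\<alpha> > 0" "l > 0" "n \<ge> 1" "0 \<le> \<tau>" "\<tau> \<le> 1"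
  shows "((1 / real n) * (\<Sum>k=1..n. (1 - l / (\<alpha> + l)) ^ k))\<^sup>2 \<le> (real n / \<alpha>) powr (- 2 * \<tau>) * l powr (- 2 * \<tau>)"
proof -
  define \<rho> where "\<rho> = 1 - l / (\<alpha> + l)"
  define s where "s = (\<Sum>k=1..n. \<rho> ^ k)"
  define z where "z = \<alpha> / (real n * l)"
  have n: "real n > 0" using assms by simp
  have \<rho>: "\<rho> = \<alpha> / (\<alpha> + l)" using assms by (simp add: \<rho>_def field_simps)
  have \<rho>01: "0 \<le> \<rho>" "\<rho> \<le> 1" using assms by (auto simp: \<rho>)
  have s0: "0 \<le> s" unfolding s_def using \<rho>01 by (intro sum_nonneg) auto
  have "s \<le> (\<Sum>k=1..n. 1)" unfolding s_def using \<rho>01 by (intro sum_mono power_le_one) auto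
  then have s1: "1 / real n * s \<le> 1" using n by simp
  have "(1 - \<rho>) * s \<le> \<rho>" unfolding s_def geometric_sum_from_1 using \<rho>01 by simp
  moreover have "1 - \<rho> = l / (\<alpha> + l)" by (simp add: \<rho>_def)
  ultimately have "(l * s) / (\<alpha> + l) \<le> \<alpha> / (\<alpha> + l)" using \<rho> by simp
  then have "l * s \<le> \<alpha>" using assms by (simp add: divide_le_cancel)
  then have s2: "1 / real n * s \<le> z"
    using assms n by (simp add: z_def field_simps)
  have "(1 / real n * s)\<^sup>2 \<le> min 1 (z\<^sup>2)"
    using s0 s1 s2 n by (auto simp del: times_divide_eq_left intro!: power_mono power_le_one)
  also have "\<dots> \<le> z powr (2 * \<tau>)"
    using assms n by (intro min_one_square_le_powr) (auto simp: z_def)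
  also have "z = inverse (real n / \<alpha> * l)" by (simp add: z_def field_simps)
  also have "inverse (real n / \<alpha> * l) powr (2 * \<tau>) = (real n / \<alpha> * l) powr (- 2 * \<tau>)"
    using inverse_powr powr_minus by (metis mult_minus_left)
  also have "\<dots> = (real n / \<alpha>) powr (- 2 * \<tau>) * l powr (- 2 * \<tau>)"
    by (rule powr_mult)
  finally show ?thesis by (simp add: s_def \<rho>_def)
qed

text \<open>
  Here \<open>c j\<close> is the total weight that the noise of step \<open>j\<close> receives in the sum of the first \<open>n\<close>
  iterates. With $\mu = l/(\alpha+l)$ and $z = nl/\alpha$, the product \<open>\<mu> * c j\<close> is at most \<open>1\<close> and
  at most \<open>n * \<mu> \<le> z\<close>, so its square is at most \<open>z powr (1 - \<tau>)\<close>. The bound follows because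
  $sl/(\alpha+l)^2 = s\mu^2/l$ and the $n$ terms carry the factor $1/n^2$.
\<close>
lemma noise_factor_bound:
  fixes \<alpha> l \<tau> s :: real
  assumes "\<alpha> > 0" "l > 0" "s > 0" "n \<ge> 1" "0 \<le> \<tau>" "\<tau> \<le> 1"
    and c: "\<And>j. j \<in> {1..n} \<Longrightarrow> 0 \<le> c j" "\<And>j. j \<in> {1..n} \<Longrightarrow> c j \<le> real n"
      "\<And>j. j \<in> {1..n} \<Longrightarrow> l / (\<alpha> + l) * c j \<le> 1"
  shows "(\<Sum>j=1..n. (1 / real n * c j)\<^sup>2) * (s * l / (\<alpha> + l)\<^sup>2)
     \<le> 1 / \<alpha> * (real n / \<alpha>) powr (- \<tau>) * (s * l powr (- \<tau>))"
proof -
  define \<mu> where "\<mu> = l / (\<alpha> + l)"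
  define z where "z = real n / \<alpha> * l"
  have n: "real n > 0" using assms by simp
  have z: "z > 0" using assms n by (simp add: z_def)
  have "l / (\<alpha> + l) \<le> l / \<alpha>" using assms by (intro divide_left_mono) auto
  then have \<mu>z: "real n * \<mu> \<le> z" 
    using mult_left_mono[of "l / (\<alpha> + l)" "l / \<alpha>" "real n"] by (simp add: z_def \<mu>_def)
  have \<mu>0: "\<mu> > 0" using assms by (simp add: \<mu>_def)
  have "(\<mu> * c j)\<^sup>2 \<le> z powr (1 - \<tau>)" if j: "j \<in> {1..n}" for j
  proof -
    have "\<mu> * c j \<le> z" 
      using mult_right_mono[OF c(2)[OF j] less_imp_le[OF \<mu>0]] \<mu>z by (metis mult.commute order_trans)
    then have "(\<mu> * c j)\<^sup>2 \<le> min 1 (z\<^sup>2)"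
      using c(1,3)[OF j] \<mu>0 by (auto simp flip: \<mu>_def intro!: power_mono power_le_one)
    also have "\<dots> \<le> z powr (1 - \<tau>)" using assms z by (intro min_one_square_le_powr) auto
    finally show ?thesis .
  qed
  then have sum: "(\<Sum>j=1..n. (\<mu> * c j)\<^sup>2) \<le> real n * z powr (1 - \<tau>)"
    using sum_mono[of "{1..n}" "\<lambda>j. (\<mu> * c j)\<^sup>2" "\<lambda>_. z powr (1 - \<tau>)"] by simp
  have "(\<Sum>j=1..n. (1 / real n * c j)\<^sup>2) * (s * l / (\<alpha> + l)\<^sup>2)
      = s / (l * (real n)\<^sup>2) * (\<Sum>j=1..n. (\<mu> * c j)\<^sup>2)"
    using assms n unfolding sum_distrib_left sum_distrib_right
    by (intro sum.cong) (simp_all add: \<mu>_def field_simps power2_eq_square)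
  also have "\<dots> \<le> s / (l * (real n)\<^sup>2) * (real n * z powr (1 - \<tau>))"
    using assms by (intro mult_left_mono sum) auto
  also have "z powr (1 - \<tau>) = z * z powr (- \<tau>)"
    using z powr_add[of z 1 "- \<tau>"] by simp
  also have "s / (l * (real n)\<^sup>2) * (real n * (z * z powr (- \<tau>))) = s / \<alpha> * z powr (- \<tau>)"
    using assms n by (simp add: z_def power2_eq_square field_simps)
  also have "z powr (- \<tau>) = (real n / \<alpha>) powr (- \<tau>) * l powr (- \<tau>)"
    unfolding z_def by (rule powr_mult)
  finally show ?thesis by (simp add: mult_ac)
qed

text \<open>
  The input of step \<open>j\<close> persists with factor \<open>\<rho> ^ (k - j)\<close> in every later \<open>e k\<close>, so its
  total weight in the sum is a geometric sum.
\<close>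
lemma affine_recursion_sum:
  fixes e \<xi> :: "nat \<Rightarrow> real"
  assumes rec: "\<And>k. k \<ge> 1 \<Longrightarrow> e k = \<rho> * e (k - 1) + \<xi> k"
  shows "(\<Sum>k=1..n. e k) = e 0 * (\<Sum>k=1..n. \<rho> ^ k) + (\<Sum>j=1..n. (\<Sum>m<Suc n - j. \<rho> ^ m) * \<xi> j)"
proof -
  have e: "e n = \<rho> ^ n * e 0 + (\<Sum>j=1..n. \<rho> ^ (n - j) * \<xi> j)" for n
  proof (induction n)
    case (Suc n)
    have "e (Suc n) = \<rho> * e n + \<xi> (Suc n)" using rec[of "Suc n"] by simp
    also have "\<dots> = \<rho> ^ Suc n * e 0 + (\<Sum>j=1..n. \<rho> * (\<rho> ^ (n - j) * \<xi> j)) + \<xi> (Suc n)"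
      unfolding Suc by (simp add: algebra_simps sum_distrib_left)
    also have "(\<Sum>j=1..n. \<rho> * (\<rho> ^ (n - j) * \<xi> j)) = (\<Sum>j=1..n. \<rho> ^ (Suc n - j) * \<xi> j)"
      by (intro sum.cong) (auto simp: Suc_diff_le)
    finally show ?case by simp
  qed simp
  show ?thesis
  proof (induction n)
    case (Suc n)
    have "(\<Sum>j=1..n. (\<Sum>m<Suc (Suc n) - j. \<rho> ^ m) * \<xi> j)
        = (\<Sum>j=1..n. (\<Sum>m<Suc n - j. \<rho> ^ m) * \<xi> j) + (\<Sum>j=1..n. \<rho> ^ (Suc n - j) * \<xi> j)"
      unfolding sum.distrib[symmetric]
      by (intro sum.cong) (auto simp: Suc_diff_le algebra_simps)
    then show ?case
      using Suc e[of "Suc n"] by (simp add: algebra_simps)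
  qed simp
qed

section \<open>Second moments of weighted Gaussian sums\<close>

context prob_space
begin

lemma normal_second_moment:
  assumes s: "0 < s" and D: "distributed M lborel X (normal_density \<mu> s)"
  shows "integrable M (\<lambda>x. (X x)\<^sup>2)" "expectation (\<lambda>x. (X x)\<^sup>2) = \<mu>\<^sup>2 + s\<^sup>2"
proof -
  have int: "integrable M X"
    using distributed_integrable[OF D, of "\<lambda>x. x"] integrable_normal_moment_nz_1[OF s] by simp
  have "integrable M (\<lambda>x. (X x - \<mu>)\<^sup>2)"
    using distributed_integrable[OF D, of "\<lambda>x. (x - \<mu>)\<^sup>2"] integrable_normal_moment[OF s, of \<mu> 2] by simp
  then have "integrable M (\<lambda>x. (X x - \<mu>)\<^sup>2 + (2 * \<mu> * X x - \<mu>\<^sup>2))"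
    using int by auto
  then show int2: "integrable M (\<lambda>x. (X x)\<^sup>2)"
    by (simp add: power2_eq_square algebra_simps)
  show "expectation (\<lambda>x. (X x)\<^sup>2) = \<mu>\<^sup>2 + s\<^sup>2"
    using variance_eq[OF int int2] normal_distributed_variance[OF s D]
      normal_distributed_expectation[OF s D] by simp
qed

text \<open>
  The sum is itself Gaussian. Positivity of the weights keeps every summand nondegenerate, so that
  it has a density.
\<close>
lemma weighted_sum_second_moment:
  assumes I: "finite I" "I \<noteq> {}" and indep: "indep_vars (\<lambda>_. borel) \<xi> I" and s: "0 < s"
    and normal: "\<And>j. j \<in> I \<Longrightarrow> distributed M lborel (\<xi> j) (normal_density 0 s)"
    and w: "\<And>j. j \<in> I \<Longrightarrow> 0 < w j"
  shows "integrable M (\<lambda>x. (b + (\<Sum>j\<in>I. w j * \<xi> j x))\<^sup>2)"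
    "expectation (\<lambda>x. (b + (\<Sum>j\<in>I. w j * \<xi> j x))\<^sup>2) = b\<^sup>2 + (\<Sum>j\<in>I. (w j)\<^sup>2) * s\<^sup>2"
proof -
  have w0: "w j \<noteq> 0" if "j \<in> I" for j using w[OF that] by simp
  define v where "v = sqrt (\<Sum>j\<in>I. (\<bar>w j\<bar> * s)\<^sup>2)"
  have pos: "0 < (\<Sum>j\<in>I. (\<bar>w j\<bar> * s)\<^sup>2)"
    using I s by (intro sum_pos) (auto simp: w0)
  then have v: "0 < v" by (simp add: v_def)
  have "distributed M lborel (\<lambda>x. 0 + w j * \<xi> j x) (normal_density (0 + w j * 0) (\<bar>w j\<bar> * s))"
    if "j \<in> I" for j
    using normal[OF that] s w[OF that] by (intro normal_density_affine) auto
  then have "distributed M lborel (\<lambda>x. \<Sum>j\<in>I. w j * \<xi> j x) (normal_density (\<Sum>j\<in>I. 0) v)"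
    unfolding v_def using I s
    by (intro sum_indep_normal indep_vars_compose2[OF indep]) (auto simp: w0)
  then have "distributed M lborel (\<lambda>x. b + 1 * (\<Sum>j\<in>I. w j * \<xi> j x)) (normal_density (b + 1 * 0) (\<bar>1\<bar> * v))"
    using v by (intro normal_density_affine) auto
  then have D: "distributed M lborel (\<lambda>x. b + (\<Sum>j\<in>I. w j * \<xi> j x)) (normal_density b v)"
    by simp
  show "integrable M (\<lambda>x. (b + (\<Sum>j\<in>I. w j * \<xi> j x))\<^sup>2)"
    by (rule normal_second_moment(1)[OF v D])
  have "v\<^sup>2 = (\<Sum>j\<in>I. (w j)\<^sup>2) * s\<^sup>2"
    using pos by (simp add: v_def power_mult_distrib sum_distrib_right)
  then show "expectation (\<lambda>x. (b + (\<Sum>j\<in>I. w j * \<xi> j x))\<^sup>2) = b\<^sup>2 + (\<Sum>j\<in>I. (w j)\<^sup>2) * s\<^sup>2"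
    using normal_second_moment(2)[OF v D] by simp
qed

end

section \<open>The error of the averaged iterates\<close>

context diagonal_problem
begin

text \<open>
  A coordinate of the iterate agrees with a sum of noise pairings only almost everywhere, which
  does not transfer measurability on a measure space that may be incomplete.
\<close>
lemma iterate_measurable:
  assumes \<alpha>: "\<alpha> > 0" and var: "is_3dvar M A S \<alpha> y u0 u"
  shows "u n \<in> borel_measurable M"
proof (induction n)
  case 0
  have "(\<lambda>\<omega>. u0) \<in> borel_measurable M" by simp
  then show ?case
    using var unfolding is_3dvar_def by (subst measurable_cong[where g = "\<lambda>_. u0"]) auto
next
  case (Suc n)
  obtain Ky where Ky_all: "\<forall>k\<ge>1. cylindrical_image M (gain A S \<alpha>) (y k) (Ky k) \<and>
      (\<forall>\<omega>\<in>space M. u k \<omega> = Ky k \<omega> + (u (k - 1) \<omega> - gain A S \<alpha> (A (u (k - 1) \<omega>))))"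
    using var unfolding is_3dvar_def by blast
  then have Ky: "Ky (Suc n) \<in> borel_measurable M"
    "\<And>\<omega>. \<omega> \<in> space M \<Longrightarrow> u (Suc n) \<omega> = Ky (Suc n) \<omega> + (u n \<omega> - gain A S \<alpha> (A (u n \<omega>)))"
    by (auto simp: cylindrical_image_def dest: spec[of _ "Suc n"])
  have "(\<lambda>x. gain A S \<alpha> (A x)) \<in> borel_measurable borel"
    by (intro borel_measurable_continuous_onI linear_continuous_on
        bounded_linear_compose[OF bounded_linear_gain[OF \<alpha>] bounded_linear_A])
  from measurable_compose[OF Suc this] Ky(1) Suc
  have "(\<lambda>\<omega>. Ky (Suc n) \<omega> + (u n \<omega> - gain A S \<alpha> (A (u n \<omega>)))) \<in> borel_measurable M"
    by (intro borel_measurable_add borel_measurable_diff)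
  then show ?case using Ky(2) by (subst measurable_cong) auto
qed

text \<open>
  In the eigenbasis the Kalman-type update decouples into scalar recursions. The realisation of
  $\mathcal Ky_k$ is tied to the noise only almost surely for each test vector; since a fixed coordinate
  involves countably many steps, one null set serves for all of them.
\<close>
lemma error_coordinate_recursion:
  assumes \<alpha>: "\<alpha> > 0" and i: "i \<ge> 1"
    and var: "is_3dvar M A S \<alpha> (observation A ud \<eta>) u0 u"
  shows "AE \<omega> in M. \<forall>k\<ge>1. inner (u k \<omega> - ud) (\<phi> i)
     = (1 - ev i / (\<alpha> + ev i)) * inner (u (k - 1) \<omega> - ud) (\<phi> i)
       + \<eta> k (adjoint (gain A S \<alpha>) (\<phi> i)) \<omega>"
proof -
  let ?v = "adjoint (gain A S \<alpha>) (\<phi> i)"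
  obtain Ky where Ky: "\<And>k. k \<ge> 1 \<Longrightarrow> cylindrical_image M (gain A S \<alpha>) (observation A ud \<eta> k) (Ky k)"
    "\<And>k \<omega>. k \<ge> 1 \<Longrightarrow> \<omega> \<in> space M \<Longrightarrow>
        u k \<omega> = Ky k \<omega> + (u (k - 1) \<omega> - gain A S \<alpha> (A (u (k - 1) \<omega>)))"
    using var unfolding is_3dvar_def by blast
  have "AE \<omega> in M. k \<ge> 1 \<longrightarrow> inner (Ky k \<omega>) (\<phi> i) = inner (A ud) ?v + \<eta> k ?v \<omega>" for k :: nat
    using Ky(1)[of k] unfolding cylindrical_image_def observation_def by (cases "k \<ge> 1") auto
  then have "AE \<omega> in M. \<forall>k::nat. k \<ge> 1 \<longrightarrow> inner (Ky k \<omega>) (\<phi> i) = inner (A ud) ?v + \<eta> k ?v \<omega>"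
    by (subst AE_all_countable) blast
  moreover have "inner (A ud) ?v = ev i / (\<alpha> + ev i) * inner ud (\<phi> i)"
    unfolding gain_inner[OF \<alpha>, symmetric] by (rule gain_A_coordinate[OF \<alpha> i])
  ultimately show ?thesis
  proof (elim AE_mp, intro AE_I2 impI allI)
    fix \<omega> and k :: nat
    assume \<omega>: "\<omega> \<in> space M" and k: "k \<ge> 1"
      and v: "inner (A ud) ?v = ev i / (\<alpha> + ev i) * inner ud (\<phi> i)"
      and "\<forall>k::nat. k \<ge> 1 \<longrightarrow> inner (Ky k \<omega>) (\<phi> i) = inner (A ud) ?v + \<eta> k ?v \<omega>"
    then have "inner (Ky k \<omega>) (\<phi> i) = ev i / (\<alpha> + ev i) * inner ud (\<phi> i) + \<eta> k ?v \<omega>" by simp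
    then show "inner (u k \<omega> - ud) (\<phi> i)
       = (1 - ev i / (\<alpha> + ev i)) * inner (u (k - 1) \<omega> - ud) (\<phi> i) + \<eta> k ?v \<omega>"
      unfolding Ky(2)[OF k \<omega>]
      by (simp only: inner_add_left inner_diff_left gain_A_coordinate[OF \<alpha> i])
         (simp only: left_diff_distrib right_diff_distrib mult_1_left)
  qed
qed

text \<open>
  Bias--variance decomposition in one coordinate. Summing the solved recursion gives a deterministic
  term and a combination of independent centred Gaussians with standard deviation
  $\gamma\|\mathcal K^*\varphi_i\|$, where
  $\|\mathcal K^*\varphi_i\|^2 = \sigma_i\lambda_i/(\alpha+\lambda_i)^2$ for $\lambda_i = \sigma_ia_i^2$.
\<close>
lemma average_error_coordinate_second_moment:
  fixes M :: "'w measure"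
  assumes M: "prob_space M" and \<gamma>: "\<gamma> > 0" and \<alpha>: "\<alpha> > 0" and i: "i \<ge> 1" and n: "n \<ge> 1"
    and noise: "iid_white_noise M \<gamma> \<eta>"
    and var: "is_3dvar M A S \<alpha> (observation A ud \<eta>) u0 u"
  defines "\<rho> \<equiv> 1 - ev i / (\<alpha> + ev i)"
  shows "integrable M (\<lambda>\<omega>. (inner (iterate_average u n \<omega> - ud) (\<phi> i))\<^sup>2)" (is ?integrable)
    and "prob_space.expectation M (\<lambda>\<omega>. (inner (iterate_average u n \<omega> - ud) (\<phi> i))\<^sup>2)
      = (1 / real n * (\<Sum>k=1..n. \<rho> ^ k) * inner (u0 - ud) (\<phi> i))\<^sup>2
        + \<gamma>\<^sup>2 * ((\<Sum>j=1..n. (1 / real n * (\<Sum>m<Suc n - j. \<rho> ^ m))\<^sup>2) * (\<sigma> i * ev i / (\<alpha> + ev i)\<^sup>2))"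
      (is ?expectation)
proof -
  interpret prob_space M by (rule M)
  define v where "v = adjoint (gain A S \<alpha>) (\<phi> i)"
  define w where "w j = 1 / real n * (\<Sum>m<Suc n - j. \<rho> ^ m)" for j
  define b where "b = 1 / real n * (\<Sum>k=1..n. \<rho> ^ k) * inner (u0 - ud) (\<phi> i)"
  have pos: "0 < ev i" "0 < \<sigma> i" "0 < a i" using ev_pos \<sigma>_pos a_pos i by auto
  have norm_v: "norm v = \<sigma> i / (\<alpha> + ev i) * a i"
    using pos \<alpha> i by (simp add: v_def adjoint_gain_basis norm_A_basis)
  then have norm_v_pos: "0 < norm v" using pos \<alpha> by simp
  have norm_v_sq: "(norm v)\<^sup>2 = \<sigma> i * ev i / (\<alpha> + ev i)\<^sup>2"
    unfolding norm_v by (simp add: power_mult_distrib power_divide ev_def power2_eq_square)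
  have \<rho>: "0 < \<rho>" using pos \<alpha> by (simp add: \<rho>_def field_simps)
  have w: "0 < w j" if "j \<in> {1..n}" for j
    unfolding w_def using that n \<rho> by (intro mult_pos_pos sum_pos) (auto simp: lessThan_empty_iff)
  have wn: "\<And>k. k \<ge> 1 \<Longrightarrow> white_noise M \<gamma> (\<eta> k)"
    and indep: "indep_vars (\<lambda>_. Pi\<^sub>M UNIV (\<lambda>_. borel)) (\<lambda>k \<omega> v. \<eta> k v \<omega>) {1..}"
    using noise unfolding iid_white_noise_def by auto
  have "indep_vars (\<lambda>_. borel) (\<lambda>k \<omega>. (\<lambda>f. f v) (\<lambda>v. \<eta> k v \<omega>)) {1..}"
    by (rule indep_vars_compose2[OF indep]) simp
  then have indep_v: "indep_vars (\<lambda>_. borel) (\<lambda>k. \<eta> k v) {1..n}"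
    by (rule indep_vars_subset) auto
  have normal: "distributed M lborel (\<eta> j v) (normal_density 0 (\<gamma> * norm v))" if "j \<in> {1..n}" for j
    using wn[of j] that norm_v_pos unfolding white_noise_def by auto
  note moment = weighted_sum_second_moment[OF _ _ indep_v _ normal w, where b = b]
  have m: "integrable M (\<lambda>\<omega>. (b + (\<Sum>j=1..n. w j * \<eta> j v \<omega>))\<^sup>2)"
    "expectation (\<lambda>\<omega>. (b + (\<Sum>j=1..n. w j * \<eta> j v \<omega>))\<^sup>2) = b\<^sup>2 + (\<Sum>j=1..n. (w j)\<^sup>2) * (\<gamma> * norm v)\<^sup>2"
    by (rule moment; use n \<gamma> norm_v_pos in simp)+
  have "AE \<omega> in M. \<omega> \<in> space M" by (rule AE_space)
  with error_coordinate_recursion[OF \<alpha> i var]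
  have eq: "AE \<omega> in M. (b + (\<Sum>j=1..n. w j * \<eta> j v \<omega>))\<^sup>2 = (inner (iterate_average u n \<omega> - ud) (\<phi> i))\<^sup>2"
  proof eventually_elim
    case (elim \<omega>)
    define e where "e k = inner (u k \<omega> - ud) (\<phi> i)" for k
    have "e k = \<rho> * e (k - 1) + \<eta> k v \<omega>" if "k \<ge> 1" for k
      using elim that by (simp add: e_def \<rho>_def v_def)
    then have sum_e: "(\<Sum>k=1..n. e k) = e 0 * (\<Sum>k=1..n. \<rho> ^ k)
        + (\<Sum>j=1..n. (\<Sum>m<Suc n - j. \<rho> ^ m) * \<eta> j v \<omega>)"
      by (rule affine_recursion_sum)
    have sum_w: "(\<Sum>j=1..n. w j * \<eta> j v \<omega>)
        = 1 / real n * (\<Sum>j=1..n. (\<Sum>m<Suc n - j. \<rho> ^ m) * \<eta> j v \<omega>)"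
      by (subst sum_distrib_left) (simp add: w_def)
    have e0: "e 0 = inner (u0 - ud) (\<phi> i)"
      using elim(2) var by (simp add: e_def is_3dvar_def)
    have "iterate_average u n \<omega> - ud = (1 / real n) *\<^sub>R (\<Sum>k=1..n. u k \<omega> - ud)"
      using n by (simp add: iterate_average_def sum_subtractf scaleR_diff_right sum_constant_scaleR)
    then have "inner (iterate_average u n \<omega> - ud) (\<phi> i) = 1 / real n * (\<Sum>k=1..n. e k)"
      by (simp add: inner_sum_left e_def)
    also have "\<dots> = b + (\<Sum>j=1..n. w j * \<eta> j v \<omega>)"
      unfolding sum_e sum_w b_def e0 by (simp only: distrib_left mult_ac)
    finally show ?case by simp
  qed
  have meas: "(\<lambda>\<omega>. (inner (iterate_average u n \<omega> - ud) (\<phi> i))\<^sup>2) \<in> borel_measurable M"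
  proof -
    have [measurable]: "u k \<in> borel_measurable M" for k by (rule iterate_measurable[OF \<alpha> var])
    show ?thesis unfolding iterate_average_def by measurable
  qed
  have meas': "(\<lambda>\<omega>. (b + (\<Sum>j=1..n. w j * \<eta> j v \<omega>))\<^sup>2) \<in> borel_measurable M"
    using m(1) by (rule borel_measurable_integrable)
  show ?integrable using integrable_cong_AE[OF meas' meas eq] m(1) by simp
  show ?expectation
    using integral_cong_AE[OF meas' meas eq] m(2)
    by (simp add: power_mult_distrib norm_v_sq b_def w_def mult_ac)
qed

lemma average_error_coordinate_bound:
  fixes M :: "'w measure"
  assumes M: "prob_space M" and \<gamma>: "\<gamma> > 0" and \<alpha>: "\<alpha> > 0" and i: "i \<ge> 1" and n: "n \<ge> 1"
    and noise: "iid_white_noise M \<gamma> \<eta>"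
    and var: "is_3dvar M A S \<alpha> (observation A ud \<eta>) u0 u"
    and \<tau>: "0 \<le> \<tau>b" "\<tau>b \<le> 1" "0 \<le> \<tau>v" "\<tau>v \<le> 1"
  shows "prob_space.expectation M (\<lambda>\<omega>. (inner (iterate_average u n \<omega> - ud) (\<phi> i))\<^sup>2)
     \<le> (real n / \<alpha>) powr (- 2 * \<tau>b) * (ev i powr (- 2 * \<tau>b) * (inner (u0 - ud) (\<phi> i))\<^sup>2)
       + \<gamma>\<^sup>2 / \<alpha> * (real n / \<alpha>) powr (- \<tau>v) * (\<sigma> i * ev i powr (- \<tau>v))"
proof -
  define \<rho> where "\<rho> = 1 - ev i / (\<alpha> + ev i)"
  have pos: "0 < ev i" "0 < \<sigma> i" using ev_pos \<sigma>_pos i by auto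
  have \<rho>: "0 \<le> \<rho>" "\<rho> \<le> 1" using pos \<alpha> by (auto simp: \<rho>_def field_simps)
  have "(1 / real n * (\<Sum>k=1..n. \<rho> ^ k) * inner (u0 - ud) (\<phi> i))\<^sup>2
      \<le> (real n / \<alpha>) powr (- 2 * \<tau>b) * ev i powr (- 2 * \<tau>b) * (inner (u0 - ud) (\<phi> i))\<^sup>2"
    unfolding power_mult_distrib[of _ "inner (u0 - ud) (\<phi> i)"] \<rho>_def
    by (intro mult_right_mono geometric_mean_bound) (use \<alpha> pos n \<tau> in auto)
  moreover have "(\<Sum>j=1..n. (1 / real n * (\<Sum>m<Suc n - j. \<rho> ^ m))\<^sup>2) * (\<sigma> i * ev i / (\<alpha> + ev i)\<^sup>2)
      \<le> 1 / \<alpha> * (real n / \<alpha>) powr (- \<tau>v) * (\<sigma> i * ev i powr (- \<tau>v))"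
  proof (rule noise_factor_bound)
    fix j assume j: "j \<in> {1..n}"
    show "0 \<le> (\<Sum>m<Suc n - j. \<rho> ^ m)" using \<rho> by (intro sum_nonneg) auto
    have "(\<Sum>m<Suc n - j. \<rho> ^ m) \<le> (\<Sum>m<Suc n - j. 1)"
      using \<rho> by (intro sum_mono power_le_one) auto
    then show "(\<Sum>m<Suc n - j. \<rho> ^ m) \<le> real n" using j by auto
    have "ev i / (\<alpha> + ev i) * (\<Sum>m<Suc n - j. \<rho> ^ m) = 1 - \<rho> ^ (Suc n - j)"
      unfolding one_diff_power_eq by (simp add: \<rho>_def)
    then show "ev i / (\<alpha> + ev i) * (\<Sum>m<Suc n - j. \<rho> ^ m) \<le> 1" using \<rho> by simp
  qed (use \<alpha> pos n \<tau> in auto)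
  then have "\<gamma>\<^sup>2 * ((\<Sum>j=1..n. (1 / real n * (\<Sum>m<Suc n - j. \<rho> ^ m))\<^sup>2) * (\<sigma> i * ev i / (\<alpha> + ev i)\<^sup>2))
      \<le> \<gamma>\<^sup>2 * (1 / \<alpha> * (real n / \<alpha>) powr (- \<tau>v) * (\<sigma> i * ev i powr (- \<tau>v)))"
    by (rule mult_left_mono) simp
  ultimately show ?thesis
    unfolding average_error_coordinate_second_moment(2)[OF M \<gamma> \<alpha> i n noise var, folded \<rho>_def]
    by (simp add: mult.assoc)
qed

text \<open>
  Summation of the coordinate bounds with the weights of the norm. All terms are nonnegative, so the
  summability of the two majorants gives the integrability as well.
\<close>
lemma average_error_bound:
  fixes M :: "'w measure"
  assumes M: "prob_space M" and \<gamma>: "\<gamma> > 0" and \<alpha>: "\<alpha> > 0" and n: "n \<ge> 1" and t: "t \<ge> 0"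
    and noise: "iid_white_noise M \<gamma> \<eta>"
    and var: "is_3dvar M A S \<alpha> (observation A ud \<eta>) u0 u"
    and \<tau>: "0 \<le> \<tau>b" "\<tau>b \<le> 1" "0 \<le> \<tau>v" "\<tau>v \<le> 1"
  defines "Gb \<equiv> \<lambda>i. \<sigma> (Suc i) powr t * ev (Suc i) powr (- 2 * \<tau>b) * (inner (u0 - ud) (\<phi> (Suc i)))\<^sup>2"
    and "Gv \<equiv> \<lambda>i. \<sigma> (Suc i) powr (t + 1) * ev (Suc i) powr (- \<tau>v)"
  assumes Gb: "summable Gb" and Gv: "summable Gv"
  shows "integrable M (\<lambda>\<omega>. (norm_scale S t (iterate_average u n \<omega> - ud))\<^sup>2)" (is ?integrable)
    and "prob_space.expectation M (\<lambda>\<omega>. (norm_scale S t (iterate_average u n \<omega> - ud))\<^sup>2)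
      \<le> (real n / \<alpha>) powr (- 2 * \<tau>b) * suminf Gb + \<gamma>\<^sup>2 / \<alpha> * (real n / \<alpha>) powr (- \<tau>v) * suminf Gv"
      (is ?bound)
proof -
  interpret prob_space M by (rule M)
  define X where "X = (real n / \<alpha>) powr (- 2 * \<tau>b)"
  define Y where "Y = \<gamma>\<^sup>2 / \<alpha> * (real n / \<alpha>) powr (- \<tau>v)"
  define f where "f i \<omega> = \<sigma> (Suc i) powr t * (inner (iterate_average u n \<omega> - ud) (\<phi> (Suc i)))\<^sup>2" for i \<omega>
  have f_sums: "(\<lambda>i. f i \<omega>) sums (norm_scale S t (iterate_average u n \<omega> - ud))\<^sup>2" for \<omega>
    unfolding f_def by (rule norm_scale_sums[OF t])
  have f_nonneg: "0 \<le> f i \<omega>" for i \<omega> by (simp add: f_def)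
  have f_int: "integrable M (f i)" for i
    unfolding f_def using average_error_coordinate_second_moment(1)[OF M \<gamma> \<alpha> _ n noise var, of "Suc i"]
    by simp
  have f_le: "expectation (f i) \<le> X * Gb i + Y * Gv i" for i
  proof -
    have "expectation (f i) = \<sigma> (Suc i) powr t * expectation (\<lambda>\<omega>. (inner (iterate_average u n \<omega> - ud) (\<phi> (Suc i)))\<^sup>2)"
      unfolding f_def by simp
    also have "\<dots> \<le> \<sigma> (Suc i) powr t * (X * (ev (Suc i) powr (- 2 * \<tau>b) * (inner (u0 - ud) (\<phi> (Suc i)))\<^sup>2)
       + Y * (\<sigma> (Suc i) * ev (Suc i) powr (- \<tau>v)))"
      unfolding X_def Y_def
      by (intro mult_left_mono average_error_coordinate_bound[OF M \<gamma> \<alpha> _ n noise var \<tau>]) auto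
    also have "\<dots> = X * Gb i + Y * Gv i"
      using \<sigma>_pos[of "Suc i"] by (simp add: Gb_def Gv_def powr_add algebra_simps)
    finally show ?thesis .
  qed
  have G: "summable (\<lambda>i. X * Gb i + Y * Gv i)"
    by (intro summable_add summable_mult Gb Gv)
  have f_norm: "norm (f i \<omega>) = f i \<omega>" for i \<omega> using f_nonneg by simp
  have sum_f: "summable (\<lambda>i. expectation (f i))"
    by (rule summable_comparison_test'[OF G, of 0])
       (use f_le f_nonneg in \<open>auto simp: integral_nonneg\<close>)
  have AE_sum: "AE \<omega> in M. summable (\<lambda>i. norm (f i \<omega>))"
    unfolding f_norm using f_sums by (auto intro: sums_summable)
  have sum_norm: "summable (\<lambda>i. expectation (\<lambda>\<omega>. norm (f i \<omega>)))"
    unfolding f_norm by (rule sum_f)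
  have eq: "(norm_scale S t (iterate_average u n \<omega> - ud))\<^sup>2 = (\<Sum>i. f i \<omega>)" for \<omega>
    using f_sums by (rule sums_unique)
  show ?integrable
    unfolding eq by (rule integrable_suminf[OF f_int AE_sum sum_norm])
  have "expectation (\<lambda>\<omega>. (norm_scale S t (iterate_average u n \<omega> - ud))\<^sup>2) = (\<Sum>i. expectation (f i))"
    unfolding eq by (rule integral_suminf[OF f_int AE_sum sum_norm])
  also have "\<dots> \<le> (\<Sum>i. X * Gb i + Y * Gv i)"
    by (rule suminf_le[OF f_le sum_f G])
  also have "\<dots> = X * suminf Gb + Y * suminf Gv"
    using suminf_add[OF summable_mult[OF Gb] summable_mult[OF Gv], of X Y]
      suminf_mult[OF Gb] suminf_mult[OF Gv] by simp
  finally show ?bound unfolding X_def Y_def .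
qed

text \<open>
  The weights in the two series that bound the error are, up to constants, powers of \<open>i\<close>. The upper
  bound on $\sigma_i$ controls the first factor and the lower bounds on $\sigma_i$ and $a_i$ control the second.
\<close>
lemma eigenvalue_powr_bound:
  assumes "\<sigma> \<asymp> (\<lambda>i. real i powr (- r))" "a \<asymp> (\<lambda>i. real i powr (- p))" "t \<ge> 0" "s \<ge> 0"
  shows "\<exists>K\<ge>0. \<forall>i\<ge>1. \<sigma> i powr t * ev i powr (- s) \<le> K * real i powr (s * (r + 2 * p) - t * r)"
proof -
  obtain c c' k where c: "c > 0" "\<And>i. i \<ge> 1 \<Longrightarrow> c * real i powr (- r) \<le> \<sigma> i"
     "\<And>i. i \<ge> 1 \<Longrightarrow> \<sigma> i \<le> c' * real i powr (- r)" "c' > 0"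
    and k: "k > 0" "\<And>i. i \<ge> 1 \<Longrightarrow> k * real i powr (- p) \<le> a i"
    using assms(1,2) unfolding comparable_def by metis
  have "\<sigma> i powr t * ev i powr (- s)
      \<le> (c' powr t * (c * k\<^sup>2) powr (- s)) * real i powr (s * (r + 2 * p) - t * r)" if i: "i \<ge> 1" for i
  proof -
    have i0: "real i > 0" using i by simp
    have "c * real i powr (- r) * (k * real i powr (- p))\<^sup>2 \<le> ev i"
      unfolding ev_def using c k i \<sigma>_pos[OF i] by (intro mult_mono power_mono) auto
    also have "c * real i powr (- r) * (k * real i powr (- p))\<^sup>2 = c * k\<^sup>2 * real i powr (- (r + 2 * p))"
      by (simp add: power_mult_distrib powr_add[symmetric] power2_eq_square)
    finally have "ev i powr (- s) \<le> (c * k\<^sup>2 * real i powr (- (r + 2 * p))) powr (- s)"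
      using c k i0 assms by (intro powr_mono2') auto
    also have "\<dots> = (c * k\<^sup>2) powr (- s) * real i powr (s * (r + 2 * p))"
      by (simp add: powr_mult powr_powr algebra_simps)
    finally have ev: "ev i powr (- s) \<le> (c * k\<^sup>2) powr (- s) * real i powr (s * (r + 2 * p))" .
    have "\<sigma> i powr t \<le> (c' * real i powr (- r)) powr t"
      using c(3)[OF i] \<sigma>_pos[OF i] assms by (intro powr_mono2) auto
    also have "\<dots> = c' powr t * real i powr (- (t * r))"
      by (simp add: powr_mult powr_powr mult.commute)
    finally have "\<sigma> i powr t * ev i powr (- s)
        \<le> (c' powr t * real i powr (- (t * r))) * ((c * k\<^sup>2) powr (- s) * real i powr (s * (r + 2 * p)))"
      using ev by (intro mult_mono) auto
    also have "\<dots> = (c' powr t * (c * k\<^sup>2) powr (- s)) * (real i powr (- (t * r)) * real i powr (s * (r + 2 * p)))"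
      by (simp only: mult_ac)
    also have "real i powr (- (t * r)) * real i powr (s * (r + 2 * p)) = real i powr (s * (r + 2 * p) - t * r)"
      by (simp flip: powr_add)
    finally show ?thesis .
  qed
  moreover have "0 \<le> c' powr t * (c * k\<^sup>2) powr (- s)" by simp
  ultimately show ?thesis by blast
qed

end

section \<open>The convergence rate\<close>

lemma summable_on_atLeast_1_imp_summable_Suc:
  fixes f :: "nat \<Rightarrow> real"
  assumes "f summable_on {1..}" "\<And>i. 0 \<le> f i"
  shows "summable (\<lambda>i. f (Suc i))"
proof -
  have "{1::nat..} = range Suc" by (auto simp: image_iff Suc_le_eq gr0_conv_Suc)
  then have "(f \<circ> Suc) summable_on UNIV"
    using assms(1) summable_on_reindex[of Suc UNIV f] by simp
  then show ?thesis
    using assms(2) by (simp add: summable_on_UNIV_nonneg_real_iff comp_def)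
qed

theorem theorem1p7:
  fixes A :: "'a::{real_inner, banach, second_countable_topology} \<Rightarrow>
              'b::{real_inner, banach, second_countable_topology}"
    and \<Sigma> :: "'a \<Rightarrow> 'a"
    and \<phi> :: "nat \<Rightarrow> 'a" and \<sigma> a :: "nat \<Rightarrow> real"
    and d :: 'a
    and \<epsilon> p \<beta> t \<tau>\<^sub>b \<tau>\<^sub>v :: real
  assumes A: "compact_operator A"
    and \<Sigma>: "bounded_linear \<Sigma>" "self_adjoint \<Sigma>" "positive_definite \<Sigma>"
    and basis: "orthonormal_basis \<phi>"
    and eig_\<Sigma>: "\<forall>i\<ge>1. \<Sigma> (\<phi> i) = \<sigma> i *\<^sub>R \<phi> i"
    and eig_A: "\<forall>i\<ge>1. adjoint A (A (\<phi> i)) = (a i)\<^sup>2 *\<^sub>R \<phi> i"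
    and "\<epsilon> > 0" and "p > 0"
    and "\<sigma> \<asymp> (\<lambda>i. real i powr (- 1 - 2 * \<epsilon>))"
    and "a \<asymp> (\<lambda>i. real i powr (- p))"
    and "\<beta> \<ge> 0" and "t \<ge> 0"
    and "\<tau>\<^sub>b \<in> {0..1}" and "\<tau>\<^sub>v \<in> {0..1}"
    and "\<tau>\<^sub>b \<le> (t * (1 + 2 * \<epsilon>) + 2 * \<beta>) / (2 * (1 + 2 * \<epsilon> + 2 * p))"
    and "\<tau>\<^sub>v < (t * (1 + 2 * \<epsilon>) + 2 * \<epsilon>) / (1 + 2 * \<epsilon> + 2 * p)"
  shows "\<exists>C>0. \<forall>u0 ud.
           u0 - ud = d \<longrightarrow>
           (\<lambda>i. real i powr (2 * \<beta>) * \<bar>inner u0 (\<phi> i) - inner ud (\<phi> i)\<bar>\<^sup>2) summable_on {1..} \<longrightarrow>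
           (\<forall>(M :: 'w measure) \<gamma> \<alpha> \<eta> u.
              prob_space M \<longrightarrow> \<gamma> > 0 \<longrightarrow> \<alpha> > 0 \<longrightarrow>
              iid_white_noise M \<gamma> \<eta> \<longrightarrow>
              is_3dvar M A \<Sigma> \<alpha> (observation A ud \<eta>) u0 u \<longrightarrow>
              (\<forall>n\<ge>1.
                 integrable M (\<lambda>\<omega>. (norm_scale \<Sigma> t (iterate_average u n \<omega> - ud))\<^sup>2) \<and>
                 prob_space.expectation M (\<lambda>\<omega>. (norm_scale \<Sigma> t (iterate_average u n \<omega> - ud))\<^sup>2)
                   \<le> C * ((real n / \<alpha>) powr (- 2 * \<tau>\<^sub>b)
                          + \<gamma>\<^sup>2 / \<alpha> * (real n / \<alpha>) powr (- \<tau>\<^sub>v))))"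
proof -
  define r where "r = 1 + 2 * \<epsilon>"
  have r: "r > 0" using \<open>\<epsilon> > 0\<close> by (simp add: r_def)
  have q: "r + 2 * p > 0" using r \<open>p > 0\<close> by simp
  have decay: "\<sigma> \<asymp> (\<lambda>i. real i powr (- r))" "a \<asymp> (\<lambda>i. real i powr (- p))"
    using assms by (simp_all add: r_def)
  interpret diagonal_problem A \<Sigma> \<phi> \<sigma> a
  proof (rule diagonal_problem.intro)
    show "0 < a i" if i: "i \<ge> 1" for i
    proof -
      obtain c where "c > 0" "c * real i powr (- p) \<le> a i"
        using decay(2) i unfolding comparable_def by blast
      moreover have "0 < real i powr (- p)" using i by simp
      ultimately show ?thesis by (smt (verit) mult_pos_pos)
    qed
  qed (use compact_operator_imp_bounded_linear[OF A] \<Sigma> basis eig_\<Sigma> eig_A in blast)+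
  define Gb where "Gb i = \<sigma> (Suc i) powr t * ev (Suc i) powr (- 2 * \<tau>\<^sub>b) * (inner d (\<phi> (Suc i)))\<^sup>2" for i
  define Gv where "Gv i = \<sigma> (Suc i) powr (t + 1) * ev (Suc i) powr (- \<tau>\<^sub>v)" for i
  have Gv: "summable Gv"
  proof -
    define s where "s = \<tau>\<^sub>v * (r + 2 * p) - (t + 1) * r"
    obtain K where K: "\<forall>i\<ge>1. \<sigma> i powr (t + 1) * ev i powr (- \<tau>\<^sub>v) \<le> K * real i powr s"
      using eigenvalue_powr_bound[OF decay, of "t + 1" \<tau>\<^sub>v] assms unfolding s_def by auto
    have "\<tau>\<^sub>v * (r + 2 * p) < t * r + 2 * \<epsilon>"
      using assms(17) q by (simp add: r_def pos_less_divide_eq)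
    then have "s < -1" by (simp add: s_def r_def algebra_simps)
    then have "summable (\<lambda>i. real (Suc i) powr s)"
      by (subst summable_Suc_iff) (simp add: summable_real_powr_iff)
    then have "summable (\<lambda>i. K * real (Suc i) powr s)" by (rule summable_mult)
    then show ?thesis
      by (rule summable_comparison_test'[where N = 0]) (use K in \<open>simp add: Gv_def del: of_nat_Suc\<close>)
  qed
  have Gb: "summable Gb" if "summable (\<lambda>i. real (Suc i) powr (2 * \<beta>) * (inner d (\<phi> (Suc i)))\<^sup>2)"
  proof -
    define s where "s = 2 * \<tau>\<^sub>b * (r + 2 * p) - t * r"
    obtain K where K: "K \<ge> 0" "\<forall>i\<ge>1. \<sigma> i powr t * ev i powr (- (2 * \<tau>\<^sub>b)) \<le> K * real i powr s"
      using eigenvalue_powr_bound[OF decay, of t "2 * \<tau>\<^sub>b"] assms unfolding s_def by auto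
    have "2 * (\<tau>\<^sub>b * (r + 2 * p)) \<le> t * r + 2 * \<beta>"
      using assms(16) q by (simp add: r_def pos_le_divide_eq mult_ac)
    then have s: "s \<le> 2 * \<beta>" by (simp add: s_def)
    have le: "Gb i \<le> K * (real (Suc i) powr (2 * \<beta>) * (inner d (\<phi> (Suc i)))\<^sup>2)" for i
    proof -
      have "\<sigma> (Suc i) powr t * ev (Suc i) powr (- 2 * \<tau>\<^sub>b) \<le> K * real (Suc i) powr s"
        using K(2)[rule_format, of "Suc i"] by simp
      also have "\<dots> \<le> K * real (Suc i) powr (2 * \<beta>)"
        using K(1) s by (intro mult_left_mono powr_mono) auto
      finally show ?thesis
        unfolding Gb_def mult.assoc[of K, symmetric] by (rule mult_right_mono) simp
    qed
    show ?thesis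
      by (rule summable_comparison_test'[OF summable_mult[OF that, of K], where N = 0])
         (use le in \<open>simp add: Gb_def\<close>)
  qed
  (* The absolute values make the constant positive also if the series for the bias diverges, when
     the smoothness hypothesis fails and the constant is irrelevant. *)
  define C where "C = 1 + \<bar>suminf Gb\<bar> + \<bar>suminf Gv\<bar>"
  show ?thesis
  proof (intro exI[of _ C] conjI allI impI)
    show "C > 0" by (simp add: C_def)
  next
    fix u0 ud :: 'a and M :: "'w measure" and \<gamma> \<alpha> :: real
      and \<eta> :: "nat \<Rightarrow> 'b \<Rightarrow> 'w \<Rightarrow> real" and u :: "nat \<Rightarrow> 'w \<Rightarrow> 'a" and n :: nat
    assume d: "u0 - ud = d"
      and smooth: "(\<lambda>i. real i powr (2 * \<beta>) * \<bar>inner u0 (\<phi> i) - inner ud (\<phi> i)\<bar>\<^sup>2) summable_on {1..}"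
      and M: "prob_space M" and \<gamma>: "\<gamma> > 0" and \<alpha>: "\<alpha> > 0" and noise: "iid_white_noise M \<gamma> \<eta>"
      and var: "is_3dvar M A \<Sigma> \<alpha> (observation A ud \<eta>) u0 u" and n: "n \<ge> 1"
    have d_coordinate: "inner u0 (\<phi> i) - inner ud (\<phi> i) = inner d (\<phi> i)" for i
      by (simp add: d[symmetric] inner_diff_left)
    have "summable (\<lambda>i. real (Suc i) powr (2 * \<beta>) * \<bar>inner d (\<phi> (Suc i))\<bar>\<^sup>2)"
      using smooth unfolding d_coordinate by (rule summable_on_atLeast_1_imp_summable_Suc) simp
    then have Gb': "summable Gb" by (intro Gb) simp
    have Gb_eq: "(\<lambda>i. \<sigma> (Suc i) powr t * ev (Suc i) powr (- 2 * \<tau>\<^sub>b) * (inner (u0 - ud) (\<phi> (Suc i)))\<^sup>2) = Gb"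
      by (simp add: Gb_def d fun_eq_iff)
    have Gv_eq: "(\<lambda>i. \<sigma> (Suc i) powr (t + 1) * ev (Suc i) powr (- \<tau>\<^sub>v)) = Gv"
      by (simp add: Gv_def fun_eq_iff)
    have \<tau>: "0 \<le> \<tau>\<^sub>b" "\<tau>\<^sub>b \<le> 1" "0 \<le> \<tau>\<^sub>v" "\<tau>\<^sub>v \<le> 1"
      using \<open>\<tau>\<^sub>b \<in> {0..1}\<close> \<open>\<tau>\<^sub>v \<in> {0..1}\<close> by auto
    note bound = average_error_bound[OF M \<gamma> \<alpha> n \<open>t \<ge> 0\<close> noise var \<tau>, unfolded Gb_eq Gv_eq, OF Gb' Gv]
    show "integrable M (\<lambda>\<omega>. (norm_scale \<Sigma> t (iterate_average u n \<omega> - ud))\<^sup>2)"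
      by (rule bound(1))
    have "(real n / \<alpha>) powr (- 2 * \<tau>\<^sub>b) * suminf Gb + \<gamma>\<^sup>2 / \<alpha> * (real n / \<alpha>) powr (- \<tau>\<^sub>v) * suminf Gv
        \<le> (real n / \<alpha>) powr (- 2 * \<tau>\<^sub>b) * C + \<gamma>\<^sup>2 / \<alpha> * (real n / \<alpha>) powr (- \<tau>\<^sub>v) * C"
      using \<alpha> by (intro add_mono mult_left_mono) (auto simp: C_def)
    also have "\<dots> = C * ((real n / \<alpha>) powr (- 2 * \<tau>\<^sub>b) + \<gamma>\<^sup>2 / \<alpha> * (real n / \<alpha>) powr (- \<tau>\<^sub>v))"
      by (simp only: distrib_left mult.commute)
    finally show "prob_space.expectation M (\<lambda>\<omega>. (norm_scale \<Sigma> t (iterate_average u n \<omega> - ud))\<^sup>2)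
        \<le> C * ((real n / \<alpha>) powr (- 2 * \<tau>\<^sub>b) + \<gamma>\<^sup>2 / \<alpha> * (real n / \<alpha>) powr (- \<tau>\<^sub>v))"
      using bound(2) by linarith
  qed
qed

end
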